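(* Let $V$ be a complex vector space of dimension $d\ge2$, polarized by a Kähler form $\omega$, and let $\omega_1,\omega_2$ be Kähler forms on $V$. Then $$\omega_1^{d-2}+\omega_1^{d-3}\wedge\omega_2+\cdots+\omega_2^{d-2}\in T^{d-2,d-2}$$ has the Hodge-Riemann property.
   Context: Let $T=\operatorname{Hom}_{\mathbb C}(V,\mathbb C)$, $\overline T$ the space of $\mathbb C$-antilinear maps $V\to\mathbb C$, and $T^{p,q}=\Lambda^pT\otimes\Lambda^q\overline T$ the space of $(p,q)$-forms on $V$. Elements of $T^{p,p}$ may be viewed as sesquilinear forms on $\Lambda^pV$; such an element is real if the corresponding form is Hermitian, and $T^{p,p}_{\mathbb R}$ is the space of real ones. A Kähler form is a real strictly positive element of $T^{1,1}$, i.e. an $\omega\in T^{1,1}_{\mathbb R}$ which for some choice of basis of $V$ (with coordinates $z_j$) can be written $\omega=i\sum_{j=1}^d dz_j\wedge d\bar z_j$. A polarized vector space is a pair $(V,\omega)$ with $\omega$ a Kähler form. Fix an isomorphism $\int:T^{d,d}_{\mathbb R}\to\mathbb R$ that is positive on positive $(d,d)$-forms (e.g. on $\omega^d$). Hodge-Riemann property: $\Omega\in T^{d-2,d-2}_{\mathbb R}$ has it (for $(V,\omega)$) if $\int\Omega\wedge\omega^2>0$ and the bilinear form $(\alpha,\alpha')\mapsto\int\alpha\wedge\Omega\wedge\alpha'$ on $T^{1,1}_{\mathbb R}$ has signature $(1,d^2-1)$. *)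

theory Defs
  imports Complex_Main "HOL-Library.Function_Algebras"
begin

text \<open>
  \<open>V\<close> is a type \<open>'v\<close> with a complex scalar multiplication \<open>scale\<close>.

  An element of \<open>T\<^sup>p\<^sup>,\<^sup>q = \<Lambda>\<^sup>p T \<otimes> \<Lambda>\<^sup>q T'\<close> (with \<open>T'\<close> the antilinear functionals) is represented by
  the corresponding function of \<open>p + q\<close> vectors, multilinear and alternating in the first \<open>p\<close>,
  antimultilinear and alternating in the last \<open>q\<close> of them. The two groups of arguments are two lists;
  a form of type \<open>(p, q)\<close> vanishes off lists of lengths \<open>p\<close> and \<open>q\<close>, so that equality of forms is
  equality of functions. A function \<open>'v list \<Rightarrow> 'v list \<Rightarrow> complex\<close> is thus an element of the whole
  bigraded algebra; its additive structure is pointwise.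
\<close>

type_synonym 'v form = "'v list \<Rightarrow> 'v list \<Rightarrow> complex"

definition cscale :: "complex \<Rightarrow> 'v form \<Rightarrow> 'v form" where
  "cscale c \<alpha> = (\<lambda>vs ws. c * \<alpha> vs ws)"

definition rscale :: "real \<Rightarrow> 'v form \<Rightarrow> 'v form" where
  "rscale r = cscale (complex_of_real r)"

definition antilinear :: "(complex \<Rightarrow> 'v::ab_group_add \<Rightarrow> 'v) \<Rightarrow> ('v \<Rightarrow> complex) \<Rightarrow> bool" where
  "antilinear scale g \<longleftrightarrow>
     (\<forall>x y. g (x + y) = g x + g y) \<and> (\<forall>c x. g (scale c x) = cnj c * g x)"

definition forms :: "(complex \<Rightarrow> 'v::ab_group_add \<Rightarrow> 'v) \<Rightarrow> nat \<Rightarrow> nat \<Rightarrow> 'v form set" where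
  "forms scale p q = {\<alpha>.
     (\<forall>vs ws. \<not> (length vs = p \<and> length ws = q) \<longrightarrow> \<alpha> vs ws = 0) \<and>
     (\<forall>vs ws. length vs = p \<longrightarrow> length ws = q \<longrightarrow>
        (\<forall>i<p. Vector_Spaces.linear scale (*) (\<lambda>x. \<alpha> (vs[i := x]) ws)) \<and>
        (\<forall>j<q. antilinear scale (\<lambda>y. \<alpha> vs (ws[j := y]))) \<and>
        (\<not> distinct vs \<or> \<not> distinct ws \<longrightarrow> \<alpha> vs ws = 0))}"

text \<open>
  For \<open>I \<subseteq> {..<n}\<close>, the shuffle listing first \<open>I\<close> and then its complement, both in increasing
  order, has sign \<open>(-1) ^ inversions I\<close>.
\<close>

definition inversions :: "nat set \<Rightarrow> nat" where
  "inversions I = card {(a, b). a \<in> I \<and> b \<notin> I \<and> b < a}"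

text \<open>
  The product of \<open>\<Lambda>(T \<oplus> T')\<close>, in the shuffle normalization
  \<open>(f \<and> g)(v, w) = f v * g w - f w * g v\<close>. Reordering
  \<open>(A \<otimes> B) \<and> (A' \<otimes> B')\<close> into \<open>(A \<and> A') \<otimes> (B \<and> B')\<close> moves \<open>B\<close> past \<open>A'\<close>, which gives the last
  contribution to the sign.
\<close>

definition wedge :: "'v form \<Rightarrow> 'v form \<Rightarrow> 'v form" (infixr "\<and>\<and>" 70) where
  "\<alpha> \<and>\<and> \<beta> = (\<lambda>vs ws.
     \<Sum>I\<in>Pow {..<length vs}. \<Sum>J\<in>Pow {..<length ws}.
       (-1) ^ (inversions I + inversions J + card J * card ({..<length vs} - I)) *
       \<alpha> (nths vs I) (nths ws J) * \<beta> (nths vs (- I)) (nths ws (- J)))"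

definition unit_form :: "'v form" where
  "unit_form = (\<lambda>vs ws. if vs = [] \<and> ws = [] then 1 else 0)"

primrec wpow :: "'v form \<Rightarrow> nat \<Rightarrow> 'v form" where
  "wpow \<alpha> 0 = unit_form"
| "wpow \<alpha> (Suc n) = \<alpha> \<and>\<and> wpow \<alpha> n"

text \<open>The inclusions of \<open>T\<close> and \<open>T'\<close> as the forms of types \<open>(1, 0)\<close> and \<open>(0, 1)\<close>.\<close>

definition form10 :: "('v \<Rightarrow> complex) \<Rightarrow> 'v form" where
  "form10 f = (\<lambda>vs ws. if length vs = 1 \<and> ws = [] then f (hd vs) else 0)"

definition form01 :: "('v \<Rightarrow> complex) \<Rightarrow> 'v form" where
  "form01 g = (\<lambda>vs ws. if vs = [] \<and> length ws = 1 then g (hd ws) else 0)"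

text \<open>
  The sesquilinear form on \<open>\<Lambda>\<^sup>p V\<close> given by a form of type \<open>(p, p)\<close>, evaluated on decomposable
  vectors. The factor is the usual one: it makes \<open>\<i> dz \<and> d(cnj z)\<close> correspond to the positive
  Hermitian form \<open>z v * cnj (z w)\<close>, and, as \<open>\<i> ^ (p + q)\<^sup>2 = (-1) ^ (p * q) * \<i> ^ p\<^sup>2 * \<i> ^ q\<^sup>2\<close>
  absorbs the sign in the wedge product, real and positive forms are compatible with products.
\<close>

definition sesq :: "nat \<Rightarrow> 'v form \<Rightarrow> 'v list \<Rightarrow> 'v list \<Rightarrow> complex" where
  "sesq p \<alpha> vs ws = \<alpha> vs ws / \<i> ^ p\<^sup>2"

definition real_forms :: "(complex \<Rightarrow> 'v::ab_group_add \<Rightarrow> 'v) \<Rightarrow> nat \<Rightarrow> 'v form set" where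
  "real_forms scale p =
     {\<alpha> \<in> forms scale p p. \<forall>vs ws. sesq p \<alpha> ws vs = cnj (sesq p \<alpha> vs ws)}"

definition kaehler_form :: "(complex \<Rightarrow> 'v::ab_group_add \<Rightarrow> 'v) \<Rightarrow> 'v form \<Rightarrow> bool" where
  "kaehler_form scale \<omega> \<longleftrightarrow> \<omega> \<in> real_forms scale 1 \<and>
     (\<exists>B. finite B \<and> \<not> module.dependent scale B \<and> module.span scale B = UNIV \<and>
        \<omega> = cscale \<i> (\<Sum>b\<in>B. form10 (\<lambda>v. module.representation scale B v b) \<and>\<and>
                            form01 (\<lambda>v. cnj (module.representation scale B v b))))"

text \<open>
  Positivity in top degree \<open>(d, d)\<close>, \<open>d = dim V\<close>: the Hermitian form on the line \<open>\<Lambda>\<^sup>d V\<close> is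
  positive definite. The nonzero elements of that line are the products of linearly independent
  vectors.
\<close>

definition positive_top_form ::
    "(complex \<Rightarrow> 'v::ab_group_add \<Rightarrow> 'v) \<Rightarrow> nat \<Rightarrow> 'v form \<Rightarrow> bool" where
  "positive_top_form scale d \<alpha> \<longleftrightarrow> \<alpha> \<in> real_forms scale d \<and>
     (\<forall>vs. length vs = d \<longrightarrow> distinct vs \<longrightarrow> \<not> module.dependent scale (set vs) \<longrightarrow>
        Re (sesq d \<alpha> vs vs) > 0)"

definition positive_integral ::
    "(complex \<Rightarrow> 'v::ab_group_add \<Rightarrow> 'v) \<Rightarrow> nat \<Rightarrow> ('v form \<Rightarrow> real) \<Rightarrow> bool" where
  "positive_integral scale d L \<longleftrightarrow>
     (\<forall>\<alpha>\<in>real_forms scale d. \<forall>\<beta>\<in>real_forms scale d. L (\<alpha> + \<beta>) = L \<alpha> + L \<beta>) \<and>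
     (\<forall>r. \<forall>\<alpha>\<in>real_forms scale d. L (rscale r \<alpha>) = r * L \<alpha>) \<and>
     bij_betw L (real_forms scale d) UNIV \<and>
     (\<forall>\<alpha>. positive_top_form scale d \<alpha> \<longrightarrow> L \<alpha> > 0)"

text \<open>
  \<open>b\<close> is a symmetric bilinear form on the real subspace \<open>W\<close>, nondegenerate of signature
  \<open>(p, q)\<close>: some basis \<open>P \<union> N\<close> of \<open>W\<close> diagonalizes it with \<open>p\<close> positive and \<open>q\<close> negative
  diagonal entries.
\<close>

definition has_signature ::
    "'v form set \<Rightarrow> ('v form \<Rightarrow> 'v form \<Rightarrow> real) \<Rightarrow> nat \<Rightarrow> nat \<Rightarrow> bool" where
  "has_signature W b p q \<longleftrightarrow>
     (\<forall>x\<in>W. \<forall>y\<in>W. b x y = b y x) \<and>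
     (\<forall>x\<in>W. \<forall>y\<in>W. \<forall>z\<in>W. b (x + y) z = b x z + b y z) \<and>
     (\<forall>r. \<forall>x\<in>W. \<forall>z\<in>W. b (rscale r x) z = r * b x z) \<and>
     (\<exists>P N. finite P \<and> finite N \<and> P \<inter> N = {} \<and> card P = p \<and> card N = q \<and>
        \<not> module.dependent rscale (P \<union> N) \<and> module.span rscale (P \<union> N) = W \<and>
        (\<forall>x\<in>P \<union> N. \<forall>y\<in>P \<union> N. x \<noteq> y \<longrightarrow> b x y = 0) \<and>
        (\<forall>x\<in>P. b x x > 0) \<and> (\<forall>x\<in>N. b x x < 0))"

definition hodge_riemann ::
    "(complex \<Rightarrow> 'v::ab_group_add \<Rightarrow> 'v) \<Rightarrow> nat \<Rightarrow> ('v form \<Rightarrow> real) \<Rightarrow> 'v form \<Rightarrow> 'v form \<Rightarrow> bool" where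
  "hodge_riemann scale d L \<omega> \<Omega> \<longleftrightarrow> \<Omega> \<in> real_forms scale (d - 2) \<and>
     L (\<Omega> \<and>\<and> wpow \<omega> 2) > 0 \<and>
     has_signature (real_forms scale 1) (\<lambda>\<alpha> \<alpha>'. L (\<alpha> \<and>\<and> \<Omega> \<and>\<and> \<alpha>')) 1 (d\<^sup>2 - 1)"

end

theory Submission
  imports Defs "HOL-Analysis.Analysis" "HOL-Computational_Algebra.Fundamental_Theorem_Algebra"
begin

text \<open>
  The two Kaehler forms are simultaneously diagonalizable: in a suitable basis
  \<open>\<omega>1 = \<i> \<Sum> dz\<^sub>i \<and> d(cnj z\<^sub>i)\<close> and \<open>\<omega>2 = \<i> \<Sum> \<lambda>\<^sub>i dz\<^sub>i \<and> d(cnj z\<^sub>i)\<close> with all \<open>\<lambda>\<^sub>i > 0\<close>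
  (\<open>simultaneous_diagonalization\<close>). Put \<open>m = d - 2\<close> and let \<open>\<Omega>\<close> be the sum of the
  \<open>\<omega>1\<^sup>m\<^sup>-\<^sup>j \<and> \<omega>2\<^sup>j\<close>. Then \<open>\<Omega>\<close> is diagonal too, and its coefficient at a set \<open>S\<close> of \<open>m\<close> basis
  vectors is \<open>\<Sum>A\<subseteq>S. |A|! |S - A|! \<Prod>i\<in>S - A. \<lambda>\<^sub>i\<close>. By Euler's beta integral this is
  \<open>(m + 1)! \<integral> \<Prod>i\<in>S. l\<^sub>i\<close> over \<open>[0, 1]\<close> with the positive affine functions \<open>l\<^sub>i t = t + (1 - t) \<lambda>\<^sub>i\<close>;
  in other words \<open>\<Omega>\<close> is, up to a factor, the average of the powers
  \<open>(t \<omega>1 + (1 - t) \<omega>2)\<^sup>m\<close> (\<open>diagonal_complete_homogeneous\<close>).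

  For real \<open>(1, 1)\<close>-forms with Hermitian matrices \<open>a\<close> and \<open>a'\<close>, the number \<open>\<integral> \<alpha> \<and> \<Omega> \<and> \<alpha>'\<close> is a
  positive multiple of \<open>\<Sum>x\<noteq>z. c\<^sub>x\<^sub>z Re (a\<^sub>x\<^sub>x a'\<^sub>z\<^sub>z - a\<^sub>x\<^sub>z a'\<^sub>z\<^sub>x)\<close>, where \<open>c\<^sub>x\<^sub>z > 0\<close> is the
  coefficient of \<open>\<Omega>\<close> at the complement of \<open>{x, z}\<close> (\<open>sesq_sandwich_diagonal\<close>,
  \<open>integral_eq_value_on_basis\<close>). The off-diagonal entries contribute negatively. What remains is the
  real quadratic form \<open>Q\<close> with matrix \<open>c\<^sub>x\<^sub>z\<close> and zero diagonal, a multiple of the Hessian at \<open>0\<close> of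
  \<open>F u = \<integral> \<Prod>i. (l\<^sub>i + u\<^sub>i)\<close>. It is negative definite on the kernel of the gradient of \<open>F\<close>. This is a
  strict infinitesimal form of the Brunn-Minkowski inequality for the polytopes
  \<open>{(t, y). 0 \<le> t \<le> 1, 0 \<le> y\<^sub>i \<le> l\<^sub>i t + u\<^sub>i}\<close>, whose volume is \<open>F u\<close>; the proof in
  \<open>hessian_negative_on_hyperplane\<close> is an explicit identity of Brascamp-Lieb type, which displays
  \<open>- Q\<close> on that hyperplane as a positive multiple of the integral of a sum of squares. A symmetric form that is negative definite on
  a hyperplane and positive at some vector has signature \<open>(1, n - 1)\<close>
  (\<open>lorentzian_orthogonal_basis\<close>), here with \<open>n = d\<^sup>2\<close>.

  Finally \<open>\<integral> \<Omega> \<and> \<omega>\<^sup>2 > 0\<close>, since it is a combination with positive coefficients of the \<open>2 \<times> 2\<close>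
  principal minors of the positive definite matrix of \<open>\<omega>\<close>.
\<close>

section \<open>An inequality for products of affine functions\<close>

definition pencil :: "real \<Rightarrow> real \<Rightarrow> real" where
  "pencil l t = t + (1 - t) * l"

lemma pencil_pos: "l > 0 \<Longrightarrow> t \<in> {0..1} \<Longrightarrow> pencil l t > 0"
proof -
  assume l: "l > 0" and t: "t \<in> {0..1}"
  show ?thesis
  proof (cases "t = 0")
    case False
    have "(1 - t) * l \<ge> 0" using l t by simp
    moreover have "t > 0" using False t by simp
    ultimately show ?thesis by (simp add: pencil_def)
  qed (use l in \<open>simp add: pencil_def\<close>)
qed

lemma pencil_deriv: "(pencil l has_real_derivative (1 - l)) (at t within S)"
  unfolding pencil_def[abs_def] by (auto intro!: derivative_eq_intros)

lemma continuous_on_pencil: "continuous_on S (pencil l)"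
  unfolding pencil_def[abs_def] by (intro continuous_intros)

text \<open>
  Let \<open>g = \<Prod>i. l\<^sub>i\<close>, \<open>y = \<Sum>j. a\<^sub>j / l\<^sub>j\<close> and \<open>p = g' / g\<close>, where \<open>l\<^sub>i\<close> is the pencil of \<open>lam i\<close>. The
  quantity to be bounded is \<open>- \<integral> R\<close> with \<open>R = g (\<Sum>j. a\<^sub>j\<^sup>2 / l\<^sub>j\<^sup>2) - g y\<^sup>2\<close>. The hypothesis
  \<open>\<integral> g y = 0\<close> makes \<open>\<psi> t = \<integral>\<^sub>0\<^sup>t g y\<close> vanish at both ends of the interval. With \<open>w = \<psi> / g\<close>, so that
  \<open>w' = y - w p\<close>, completing squares gives
  \<open>R + (2 \<psi> y - \<psi>\<^sup>2 p / g)' = g (\<Sum>j. ((a\<^sub>j - w l\<^sub>j') / l\<^sub>j)\<^sup>2) + g (w')\<^sup>2 = D\<close>, and the total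
  derivative integrates to \<open>0\<close>. Hence \<open>\<integral> R = \<integral> D \<ge> 0\<close>, and strictly so because
  \<open>D 0 \<ge> g 0 (\<Sum>j. a\<^sub>j\<^sup>2 / (l\<^sub>j 0)\<^sup>2) > 0\<close>.
\<close>

lemma hessian_negative_on_hyperplane:
  fixes lam a :: "'i \<Rightarrow> real"
  assumes fin: "finite I" and lam: "\<And>i. i \<in> I \<Longrightarrow> lam i > 0"
    and mean: "(\<Sum>j\<in>I. a j * integral {0..1} (\<lambda>t. \<Prod>i\<in>I - {j}. pencil (lam i) t)) = 0"
    and j0: "j0 \<in> I" "a j0 \<noteq> 0"
  shows "(\<Sum>j\<in>I. \<Sum>k\<in>I - {j}. a j * a k *
            integral {0..1} (\<lambda>t. \<Prod>i\<in>I - {j, k}. pencil (lam i) t)) < 0"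
proof -
  define l where "l i t = pencil (lam i) t" for i t
  define g where "g t = (\<Prod>i\<in>I. l i t)" for t
  define y where "y t = (\<Sum>j\<in>I. a j / l j t)" for t
  define p where "p t = (\<Sum>j\<in>I. (1 - lam j) / l j t)" for t
  define y' where "y' t = - (\<Sum>j\<in>I. a j * (1 - lam j) / (l j t)\<^sup>2)" for t
  define p' where "p' t = - (\<Sum>j\<in>I. (1 - lam j)\<^sup>2 / (l j t)\<^sup>2)" for t
  define q where "q t = (\<Sum>j\<in>I. (a j)\<^sup>2 / (l j t)\<^sup>2)" for t
  define \<psi> where "\<psi> t = integral {0..t} (\<lambda>s. g s * y s)" for t
  define w where "w t = \<psi> t / g t" for t
  define D where "D t = g t * (\<Sum>j\<in>I. ((a j - w t * (1 - lam j)) / l j t)\<^sup>2) + g t * (y t - w t * p t)\<^sup>2" for t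
  define R where "R t = g t * q t - g t * (y t)\<^sup>2" for t
  define K where "K t = 2 * \<psi> t * y t - (\<psi> t)\<^sup>2 * p t / g t" for t
  have lpos: "l i t > 0" if "i \<in> I" "t \<in> {0..1}" for i t
    using that lam pencil_pos by (auto simp: l_def)
  have lcont: "continuous_on {0..1} (l i)" for i
    unfolding l_def[abs_def] by (intro continuous_on_pencil)
  have gpos: "g t > 0" if "t \<in> {0..1}" for t
    using lpos that by (auto simp: g_def intro!: prod_pos)
  have gcont: "continuous_on {0..1} g"
    unfolding g_def by (intro continuous_intros lcont)
  have lD': "(l i has_real_derivative (1 - lam i)) (at t)" for i t
    unfolding l_def[abs_def] by (rule pencil_deriv)
  have ln0: "l i t \<noteq> 0" if "i \<in> I" "t \<in> {0..1}" for i t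
    using lpos[OF that] by simp
  have ycont: "continuous_on {0..1} y"
    unfolding y_def by (intro continuous_intros lcont) (use ln0 in auto)
  have pcont: "continuous_on {0..1} p"
    unfolding p_def by (intro continuous_intros lcont) (use ln0 in auto)
  have qcont: "continuous_on {0..1} q"
    unfolding q_def by (intro continuous_intros lcont) (use ln0 in auto)
  have lD: "(l i has_real_derivative (1 - lam i)) (at t within {0..1})" for i t
    unfolding l_def[abs_def] by (rule pencil_deriv)
  have \<psi>D: "(\<psi> has_real_derivative g t * y t) (at t within {0..1})" if "t \<in> {0..1}" for t
    unfolding \<psi>_def[abs_def]
    by (rule integral_has_real_derivative[OF _ that]) (intro continuous_intros gcont ycont)
  have \<psi>cont: "continuous_on {0..1} \<psi>"
    by (rule DERIV_continuous_on[OF \<psi>D])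
  have gD: "(g has_real_derivative g t * p t) (at t within {0..1})" if "t \<in> {0..1}" for t
    unfolding g_def[abs_def] p_def
    by (rule has_field_derivative_at_within, rule has_field_derivative_prod')
       (use ln0[OF _ that] lD' in blast)+
  have yD: "(y has_real_derivative y' t) (at t within {0..1})" if t: "t \<in> {0..1}" for t
    unfolding y_def[abs_def] y'_def sum_negf[symmetric]
    by (rule DERIV_sum)
       (auto intro!: derivative_eq_intros lD simp: ln0[OF _ t] power2_eq_square)
  have pD: "(p has_real_derivative p' t) (at t within {0..1})" if t: "t \<in> {0..1}" for t
    unfolding p_def[abs_def] p'_def sum_negf[symmetric]
    by (rule DERIV_sum)
       (auto intro!: derivative_eq_intros lD simp: ln0[OF _ t] power2_eq_square)
  have Dexp: "D t = g t * q t + 2 * g t * w t * y' t - g t * (w t)\<^sup>2 * p' t + g t * (y t - w t * p t)\<^sup>2" for t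
  proof -
    have sq: "((A - W * B) / L)\<^sup>2 = A\<^sup>2 / L\<^sup>2 - 2 * W * (A * B / L\<^sup>2) + W\<^sup>2 * (B\<^sup>2 / L\<^sup>2)" for A B L W :: real
      by (simp add: power2_eq_square algebra_simps add_divide_distrib diff_divide_distrib)
    have "(\<Sum>j\<in>I. ((a j - w t * (1 - lam j)) / l j t)\<^sup>2) =
          (\<Sum>j\<in>I. (a j)\<^sup>2 / (l j t)\<^sup>2 - 2 * w t * (a j * (1 - lam j) / (l j t)\<^sup>2)
                  + (w t)\<^sup>2 * ((1 - lam j)\<^sup>2 / (l j t)\<^sup>2))"
      by (intro sum.cong refl sq)
    also have "\<dots> = q t + 2 * w t * y' t - (w t)\<^sup>2 * p' t"
      by (simp add: q_def y'_def p'_def sum.distrib sum_subtractf sum_distrib_left)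
    finally have S: "(\<Sum>j\<in>I. ((a j - w t * (1 - lam j)) / l j t)\<^sup>2) = q t + 2 * w t * y' t - (w t)\<^sup>2 * p' t" .
    show ?thesis unfolding D_def S by (simp add: algebra_simps)
  qed
  have KD: "(K has_real_derivative (D t - R t)) (at t within {0..1})" if t: "t \<in> {0..1}" for t
  proof -
    have g0: "g t \<noteq> 0" using gpos[OF t] by simp
    have \<psi>w: "\<psi> t = g t * w t" using g0 by (simp add: w_def)
    have "(K has_real_derivative
       (2 * (g t * y t) * y t + 2 * \<psi> t * y' t) -
       ((2 * \<psi> t * (g t * y t) * p t + (\<psi> t)\<^sup>2 * p' t) * g t - (\<psi> t)\<^sup>2 * p t * (g t * p t)) / (g t * g t)) (at t within {0..1})"
      unfolding K_def[abs_def]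
      by (rule derivative_eq_intros \<psi>D yD pD gD t g0 refl | simp add: algebra_simps)+
    also have "(2 * (g t * y t) * y t + 2 * \<psi> t * y' t) -
       ((2 * \<psi> t * (g t * y t) * p t + (\<psi> t)\<^sup>2 * p' t) * g t - (\<psi> t)\<^sup>2 * p t * (g t * p t)) / (g t * g t) = D t - R t"
      unfolding Dexp R_def \<psi>w using g0
      by (simp add: field_simps power2_eq_square)
    finally show ?thesis .
  qed
  have w_cont: "continuous_on {0..1} w"
    unfolding w_def using gpos by (intro continuous_intros \<psi>cont gcont) fastforce
  have D_cont: "continuous_on {0..1} D"
    unfolding D_def by (intro continuous_intros gcont lcont w_cont ycont pcont) (use ln0 in auto)
  have R_cont: "continuous_on {0..1} R"
    unfolding R_def by (intro continuous_intros gcont qcont ycont)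
  have prod1: "g t / l j t = (\<Prod>i\<in>I - {j}. l i t)" if "j \<in> I" "t \<in> {0..1}" for j t
    using fin that ln0[OF that] by (simp add: g_def prod.remove[of I j])
  have prod2: "g t / (l j t * l k t) = (\<Prod>i\<in>I - {j, k}. l i t)" if "j \<in> I" "k \<in> I - {j}" "t \<in> {0..1}" for j k t
  proof -
    have "g t / (l j t * l k t) = (\<Prod>i\<in>I - {j}. l i t) / l k t"
      using prod1[of j t] that by (metis divide_divide_eq_left)
    also have "\<dots> = (\<Prod>i\<in>I - {j} - {k}. l i t)"
      using fin that ln0[of k t] by (simp add: prod.remove[of "I - {j}" k])
    also have "I - {j} - {k} = I - {j, k}" by auto
    finally show ?thesis .
  qed
  have int1: "(\<lambda>t. \<Prod>i\<in>A. l i t) integrable_on {0..1}" for A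
    by (intro integrable_continuous_interval continuous_intros lcont)
  have \<psi>0: "\<psi> 0 = 0" by (simp add: \<psi>_def)
  have \<psi>1: "\<psi> 1 = 0"
  proof -
    have "\<psi> 1 = integral {0..1} (\<lambda>t. \<Sum>j\<in>I. a j * (\<Prod>i\<in>I - {j}. l i t))"
      unfolding \<psi>_def
    proof (rule integral_cong)
      fix t :: real assume t: "t \<in> {0..1}"
      have "g t * y t = (\<Sum>j\<in>I. a j * (g t / l j t))"
        by (simp add: y_def sum_distrib_left algebra_simps)
      also have "\<dots> = (\<Sum>j\<in>I. a j * (\<Prod>i\<in>I - {j}. l i t))"
        using prod1 t by (intro sum.cong) auto
      finally show "g t * y t = (\<Sum>j\<in>I. a j * (\<Prod>i\<in>I - {j}. l i t))" .
    qed
    also have "\<dots> = (\<Sum>j\<in>I. a j * integral {0..1} (\<lambda>t. \<Prod>i\<in>I - {j}. l i t))"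
      by (subst integral_sum[OF fin]) (auto intro!: integrable_on_mult_right int1)
    finally show ?thesis using mean by (simp add: l_def)
  qed
  have "((\<lambda>t. D t - R t) has_integral (K 1 - K 0)) {0..1}"
    by (rule fundamental_theorem_of_calculus)
       (auto intro!: KD simp: has_real_derivative_iff_has_vector_derivative[symmetric])
  then have "integral {0..1} (\<lambda>t. D t - R t) = 0"
    by (simp add: K_def \<psi>0 \<psi>1 integral_unique)
  then have DR: "integral {0..1} D = integral {0..1} R"
    by (subst (asm) integral_diff) (auto intro!: integrable_continuous_interval D_cont R_cont)
  have D_nonneg: "D t \<ge> 0" if "t \<in> {0..1}" for t
    unfolding D_def using gpos[OF that] by (intro add_nonneg_nonneg mult_nonneg_nonneg sum_nonneg) auto
  \<comment> \<open>As \<open>w\<close> vanishes at \<open>0\<close>, the squares there involve only the \<open>a j\<close>.\<close>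
  have "D 0 > 0"
  proof -
    have "(\<Sum>j\<in>I. (a j / l j 0)\<^sup>2) > 0"
      using fin j0 ln0[of j0 0] by (intro sum_pos2[of I j0]) auto
    then show ?thesis
      unfolding D_def using gpos[of 0] by (simp add: w_def \<psi>0 add_pos_nonneg)
  qed
  then have "integral {0..1} D \<noteq> 0"
    using integral_eq_0_iff[OF D_cont _ D_nonneg] by fastforce
  moreover have "integral {0..1} D \<ge> 0"
    using D_nonneg by (intro integral_nonneg integrable_continuous_interval D_cont) auto
  ultimately have pos: "integral {0..1} R > 0" using DR by simp
  have "integral {0..1} R = integral {0..1} (\<lambda>t. - (\<Sum>j\<in>I. \<Sum>k\<in>I - {j}. a j * a k * (\<Prod>i\<in>I - {j, k}. l i t)))"
  proof (rule integral_cong)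
    fix t :: real assume t: "t \<in> {0..1}"
    have "(y t)\<^sup>2 = (\<Sum>j\<in>I. \<Sum>k\<in>I. (a j / l j t) * (a k / l k t))"
      by (simp add: y_def power2_eq_square sum_product)
    also have "\<dots> = (\<Sum>j\<in>I. (a j / l j t) * (a j / l j t) + (\<Sum>k\<in>I - {j}. (a j / l j t) * (a k / l k t)))"
      by (intro sum.cong refl sum.remove fin)
    also have "\<dots> = q t + (\<Sum>j\<in>I. \<Sum>k\<in>I - {j}. (a j / l j t) * (a k / l k t))"
      by (simp add: sum.distrib q_def power2_eq_square)
    finally have "R t = - (\<Sum>j\<in>I. \<Sum>k\<in>I - {j}. a j * a k * (g t / (l j t * l k t)))"
      by (simp add: R_def sum_distrib_left algebra_simps)
    also have "\<dots> = - (\<Sum>j\<in>I. \<Sum>k\<in>I - {j}. a j * a k * (\<Prod>i\<in>I - {j, k}. l i t))"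
      using prod2 t by simp
    finally show "R t = - (\<Sum>j\<in>I. \<Sum>k\<in>I - {j}. a j * a k * (\<Prod>i\<in>I - {j, k}. l i t))" .
  qed
  also have "\<dots> = - (\<Sum>j\<in>I. \<Sum>k\<in>I - {j}. a j * a k * integral {0..1} (\<lambda>t. \<Prod>i\<in>I - {j, k}. l i t))"
    using fin by (simp add: integral_sum integrable_sum integrable_on_mult_right int1)
  finally show ?thesis using pos by (simp add: l_def)
qed

section \<open>Alternating functions and shuffle products\<close>

definition complex_linear :: "(complex \<Rightarrow> 'v::ab_group_add \<Rightarrow> 'v) \<Rightarrow> ('v \<Rightarrow> complex) \<Rightarrow> bool" where
  "complex_linear sc f \<longleftrightarrow> (\<forall>x y. f (x + y) = f x + f y) \<and> (\<forall>c x. f (sc c x) = c * f x)"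

lemma complex_linear_zero [simp]: "complex_linear sc (\<lambda>x. 0)"
  by (simp add: complex_linear_def)

lemma complex_linear_add: "complex_linear sc f \<Longrightarrow> complex_linear sc g \<Longrightarrow> complex_linear sc (\<lambda>x. f x + g x)"
  by (simp add: complex_linear_def algebra_simps)

lemma complex_linear_cmult: "complex_linear sc f \<Longrightarrow> complex_linear sc (\<lambda>x. c * f x)"
  by (simp add: complex_linear_def algebra_simps)

lemma complex_linear_multc: "complex_linear sc f \<Longrightarrow> complex_linear sc (\<lambda>x. f x * c)"
  by (simp add: complex_linear_def algebra_simps)

lemma complex_linear_sum: "(\<And>i. i \<in> A \<Longrightarrow> complex_linear sc (f i)) \<Longrightarrow> complex_linear sc (\<lambda>x. \<Sum>i\<in>A. f i x)"
  by (induction A rule: infinite_finite_induct) (auto intro: complex_linear_add)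

lemma complex_linear_apply_sum:
  assumes "complex_linear sc f" shows "f (\<Sum>i\<in>A. sc (c i) (x i)) = (\<Sum>i\<in>A. c i * f (x i))"
proof -
  have "f 0 = 0" using assms unfolding complex_linear_def by (metis add.right_neutral add_cancel_left_right)
  then show ?thesis
    using assms by (induction A rule: infinite_finite_induct) (auto simp: complex_linear_def)
qed

lemma linear_iff_complex_linear:
  "vector_space sc \<Longrightarrow> Vector_Spaces.linear sc (*) f \<longleftrightarrow> complex_linear sc f"
proof -
  assume v: "vector_space sc"
  have "vector_space ((*) :: complex \<Rightarrow> complex \<Rightarrow> complex)"
    by unfold_locales (auto simp: algebra_simps)
  with v show ?thesis
    by (auto simp: Vector_Spaces.linear_iff complex_linear_def)
qed

definition alternating :: "(complex \<Rightarrow> 'v::ab_group_add \<Rightarrow> 'v) \<Rightarrow> nat \<Rightarrow> ('v list \<Rightarrow> complex) \<Rightarrow> bool" where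
  "alternating sc p f \<longleftrightarrow>
     (\<forall>vs. length vs \<noteq> p \<longrightarrow> f vs = 0) \<and>
     (\<forall>vs i. i < length vs \<longrightarrow> complex_linear sc (\<lambda>x. f (vs[i := x]))) \<and>
     (\<forall>vs. \<not> distinct vs \<longrightarrow> f vs = 0)"

lemma alternating_length: "alternating sc p f \<Longrightarrow> length vs \<noteq> p \<Longrightarrow> f vs = 0"
  by (simp add: alternating_def)

lemma alternating_complex_linear: "alternating sc p f \<Longrightarrow> i < length vs \<Longrightarrow> complex_linear sc (\<lambda>x. f (vs[i := x]))"
  by (simp add: alternating_def)

lemma alternating_distinct: "alternating sc p f \<Longrightarrow> \<not> distinct vs \<Longrightarrow> f vs = 0"
  by (simp add: alternating_def)

lemma alternating_zero [simp]: "alternating sc p (\<lambda>vs. 0)"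
  by (simp add: alternating_def)

lemma alternating_add:
  "alternating sc p f \<Longrightarrow> alternating sc p g \<Longrightarrow> alternating sc p (\<lambda>vs. f vs + g vs)"
  by (simp add: alternating_def complex_linear_add)

lemma alternating_cmult: "alternating sc p f \<Longrightarrow> alternating sc p (\<lambda>vs. c * f vs)"
  by (simp add: alternating_def complex_linear_cmult)

lemma alternating_sum:
  "(\<And>i. i \<in> A \<Longrightarrow> alternating sc p (f i)) \<Longrightarrow> alternating sc p (\<lambda>vs. \<Sum>i\<in>A. f i vs)"
  by (induction A rule: infinite_finite_induct) (auto intro: alternating_add)

lemma alternating_contract: "alternating sc p f \<Longrightarrow> alternating sc (p - 1) (\<lambda>xs. f (v # xs))"
  unfolding alternating_def
proof (elim conjE, intro conjI allI impI)
  fix vs :: "'a list" and i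
  assume *: "\<forall>vs i. i < length vs \<longrightarrow> complex_linear sc (\<lambda>x. f (vs[i := x]))" and "i < length vs"
  then have "complex_linear sc (\<lambda>x. f ((v # vs)[Suc i := x]))"
    using spec[OF spec[OF *, of "v # vs"], of "Suc i"] by simp
  then show "complex_linear sc (\<lambda>x. f (v # vs[i := x]))" by simp
qed auto

lemma alternating_complex_linear_head: "alternating sc p f \<Longrightarrow> complex_linear sc (\<lambda>x. f (x # xs))"
  using alternating_complex_linear[of sc p f 0 "undefined # xs"] by simp

lemma alternating_swap:
  assumes f: "alternating sc p f" and ij: "i < length vs" "j < length vs" "i \<noteq> j"
  shows "f (vs[i := x, j := y]) = - f (vs[i := y, j := x])"
proof -
  define F where "F a b = f (vs[i := a, j := b])" for a b
  have diag: "F a a = 0" for a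
  proof -
    have "\<not> distinct (vs[i := a, j := a])"
    proof -
      have "vs[i := a, j := a] ! i = vs[i := a, j := a] ! j" using ij by simp
      then show ?thesis using ij by (metis nth_eq_iff_index_eq length_list_update)
    qed
    then show ?thesis using alternating_distinct[OF f] by (simp add: F_def)
  qed
  have add2: "F a (b + c) = F a b + F a c" for a b c
    using alternating_complex_linear[OF f, of j "vs[i := a]"] ij by (simp add: F_def complex_linear_def)
  have add1: "F (a + b) c = F a c + F b c" for a b c
    using alternating_complex_linear[OF f, of i "vs[j := c]"] ij
    by (simp add: F_def complex_linear_def list_update_swap)
  have "F (x + y) (x + y) = F x y + F y x"
    using diag[of x] diag[of y] by (simp add: add1 add2)
  then have "F x y = - F y x" using diag by (simp add: add_eq_0_iff2)
  then show ?thesis by (simp add: F_def)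
qed

lemma alternating_swap_head: "alternating sc p f \<Longrightarrow> f (u # v # xs) = - f (v # u # xs)"
  using alternating_swap[of sc p f 0 "u # v # xs" 1 u v] by simp

lemma finite_inversions: "finite I \<Longrightarrow> finite {(a, b). a \<in> I \<and> b \<notin> I \<and> b < (a::nat)}"
  by (rule finite_subset[of _ "I \<times> {..<Suc (Max I)}"])
     (auto simp: less_Suc_eq_le dest: Max_ge intro: order_trans less_imp_le)

lemma inversions_Suc:
  assumes "finite I" shows "inversions (Suc ` I) = inversions I + card I"
proof -
  have "{(a, b). a \<in> Suc ` I \<and> b \<notin> Suc ` I \<and> b < a} =
        map_prod Suc Suc ` {(a, b). a \<in> I \<and> b \<notin> I \<and> b < a} \<union> (\<lambda>a. (Suc a, 0)) ` I" (is "_ = ?A \<union> ?B")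
  proof (intro equalityI subsetI)
    fix z assume "z \<in> {(a, b). a \<in> Suc ` I \<and> b \<notin> Suc ` I \<and> b < a}"
    then obtain a b where z: "z = (Suc a, b)" "a \<in> I" "b \<notin> Suc ` I" "b < Suc a" by auto
    then show "z \<in> ?A \<union> ?B" by (cases b) (auto simp: image_iff)
  qed auto
  moreover have "card (?A \<union> ?B) = card ?A + card ?B"
    using assms finite_inversions[OF assms] by (intro card_Un_disjoint) auto
  moreover have "card ?A = inversions I"
    unfolding inversions_def by (rule card_image) (auto simp: inj_on_def)
  moreover have "card ?B = card I" by (rule card_image) (auto simp: inj_on_def)
  ultimately show ?thesis by (simp add: inversions_def)
qed

lemma inversions_insert_0: "inversions (insert 0 (Suc ` I)) = inversions I"
proof -
  have "{(a, b). a \<in> insert 0 (Suc ` I) \<and> b \<notin> insert 0 (Suc ` I) \<and> b < a} =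
        map_prod Suc Suc ` {(a, b). a \<in> I \<and> b \<notin> I \<and> b < a}" (is "?L = ?A")
  proof (intro equalityI subsetI)
    fix z assume "z \<in> ?L"
    then obtain a b where z: "z = (Suc a, b)" "a \<in> I" "b \<notin> Suc ` I" "b \<noteq> 0" "b < Suc a" by auto
    then show "z \<in> ?A" by (cases b) (auto simp: image_iff)
  qed auto
  moreover have "card ?A = inversions I"
    unfolding inversions_def by (rule card_image) (auto simp: inj_on_def)
  ultimately show ?thesis by (simp add: inversions_def)
qed

lemma sum_Pow_lessThan_Suc:
  fixes h :: "nat set \<Rightarrow> 'b::comm_monoid_add"
  shows "(\<Sum>I\<in>Pow {..<Suc n}. h I) =
    (\<Sum>I\<in>Pow {..<n}. h (insert 0 (Suc ` I))) + (\<Sum>I\<in>Pow {..<n}. h (Suc ` I))"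
proof -
  have eq: "Pow {..<Suc n} = (\<lambda>I. insert 0 (Suc ` I)) ` Pow {..<n} \<union> (`) Suc ` Pow {..<n}"
    unfolding lessThan_Suc_eq_insert_0 Pow_insert image_Pow_surj[OF refl, symmetric]
    by (auto simp: image_image)
  have inj1: "inj_on (\<lambda>I. insert 0 (Suc ` I)) (Pow {..<n})"
  proof (rule inj_onI)
    fix I J assume "insert 0 (Suc ` I) = insert 0 (Suc ` J)"
    then have "insert 0 (Suc ` I) - {0} = insert 0 (Suc ` J) - {0}" by simp
    then have "Suc ` I = Suc ` J" by auto
    then show "I = J" by (simp add: inj_image_eq_iff)
  qed
  have inj2: "inj_on ((`) Suc) (Pow {..<n})"
    by (rule inj_onI) (simp add: inj_image_eq_iff)
  show ?thesis
    unfolding eq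
    by (subst sum.union_disjoint) (auto simp: sum.reindex[OF inj1] sum.reindex[OF inj2])
qed

lemma length_nths_lessThan: "I \<subseteq> {..<length vs} \<Longrightarrow> length (nths vs I) = card I"
  unfolding length_nths by (rule arg_cong[of _ _ card]) auto

lemma length_nths_compl: "length (nths vs (- I)) = card ({..<length vs} - I)"
  unfolding length_nths by (rule arg_cong[of _ _ card]) auto

text \<open>
  The product of forms, restricted to one of the two groups of arguments. Once the arguments in the
  other group and their distribution to the factors are fixed, a product of forms is a signed sum of
  such products, so closure properties need only be proved here.
\<close>

definition shuffle :: "('v list \<Rightarrow> complex) \<Rightarrow> ('v list \<Rightarrow> complex) \<Rightarrow> 'v list \<Rightarrow> complex" where
  "shuffle f g vs =
     (\<Sum>I\<in>Pow {..<length vs}. (-1) ^ inversions I * f (nths vs I) * g (nths vs (- I)))"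

lemma shuffle_zero_left [simp]: "shuffle (\<lambda>vs. 0) g vs = 0"
  by (simp add: shuffle_def)

text \<open>
  Contraction with a vector is an antiderivation: the first argument goes to one of the factors, and if
  it goes to \<open>g\<close> it passes the \<open>p\<close> arguments of \<open>f\<close>.
\<close>

lemma shuffle_Cons:
  assumes f: "alternating sc p f"
  shows "shuffle f g (v # vs) =
    shuffle (\<lambda>xs. f (v # xs)) g vs + (-1) ^ p * shuffle f (\<lambda>xs. g (v # xs)) vs"
proof -
  have sets: "{j. Suc j \<in> insert 0 (Suc ` I)} = I" "{j. Suc j \<in> - insert 0 (Suc ` I)} = - I"
    "{j. Suc j \<in> Suc ` I} = I" "{j. Suc j \<in> - Suc ` I} = - I" for I by auto
  have *: "(-1) ^ inversions (Suc ` I) * f (nths vs I) * g (v # nths vs (- I)) =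
        (-1) ^ p * ((-1) ^ inversions I * f (nths vs I) * g (v # nths vs (- I)))"
    if I: "I \<in> Pow {..<length vs}" for I
  proof (cases "length (nths vs I) = p")
    case True
    moreover have "finite I" using I finite_subset by blast
    ultimately show ?thesis
      using I length_nths_lessThan[of I vs] by (simp add: inversions_Suc power_add)
  qed (simp add: alternating_length[OF f])
  have "shuffle f g (v # vs) =
     (\<Sum>I\<in>Pow {..<length vs}. (-1) ^ inversions I * f (v # nths vs I) * g (nths vs (- I))) +
     (\<Sum>I\<in>Pow {..<length vs}. (-1) ^ inversions (Suc ` I) * f (nths vs I) * g (v # nths vs (- I)))"
    unfolding shuffle_def length_Cons sum_Pow_lessThan_Suc
    by (simp only: nths_Cons sets inversions_insert_0) (simp cong: sum.cong)
  also have "(\<Sum>I\<in>Pow {..<length vs}. (-1) ^ inversions (Suc ` I) * f (nths vs I) * g (v # nths vs (- I))) =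
      (-1) ^ p * shuffle f (\<lambda>xs. g (v # xs)) vs"
    unfolding shuffle_def sum_distrib_left by (intro sum.cong refl *)
  finally show ?thesis by (simp add: shuffle_def)
qed

lemma shuffle_uminus_left: "shuffle (\<lambda>xs. - f xs) g vs = - shuffle f g vs"
  and shuffle_uminus_right: "shuffle f (\<lambda>xs. - g xs) vs = - shuffle f g vs"
  by (simp_all add: shuffle_def sum_negf)

text \<open>
  Contracting twice, the terms in which both vectors go to the same factor change sign because this
  factor alternates; the mixed terms are exchanged with opposite signs.
\<close>

lemma shuffle_swap_head:
  assumes f: "alternating sc p f" and g: "alternating sc q g"
  shows "shuffle f g (u # v # vs) = - shuffle f g (v # u # vs)"
proof -
  have f2: "(\<lambda>xs. f (v # u # xs)) = (\<lambda>xs. - f (u # v # xs))"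
    and g2: "(\<lambda>xs. g (v # u # xs)) = (\<lambda>xs. - g (u # v # xs))"
    using alternating_swap_head[OF f, of v u] alternating_swap_head[OF g, of v u] by auto
  show ?thesis
  proof (cases p)
    case 0
    then have "(\<lambda>xs. f (w # xs)) = (\<lambda>xs. 0)" for w using alternating_length[OF f] by auto
    then show ?thesis
      by (simp add: shuffle_Cons[OF f] 0 g2 shuffle_uminus_right)
  next
    case (Suc p')
    have "shuffle f g (a # b # vs) = shuffle (\<lambda>xs. f (a # b # xs)) g vs +
        (-1) ^ p' * shuffle (\<lambda>xs. f (a # xs)) (\<lambda>xs. g (b # xs)) vs -
        (-1) ^ p' * shuffle (\<lambda>xs. f (b # xs)) (\<lambda>xs. g (a # xs)) vs +
        shuffle f (\<lambda>xs. g (a # b # xs)) vs" for a b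
      unfolding shuffle_Cons[OF f] shuffle_Cons[OF alternating_contract[OF f]]
      using Suc by (cases "even p'") simp_all
    then show ?thesis
      by (simp only: f2 g2 shuffle_uminus_left shuffle_uminus_right) simp
  qed
qed

text \<open>
  Either a repetition occurs in the tail, where the recursion of \<open>shuffle_Cons\<close> applies, or it
  involves the head, which can be moved past the second entry into this situation.
\<close>

lemma shuffle_not_distinct:
  assumes "alternating sc p f" "alternating sc q g" "\<not> distinct vs"
  shows "shuffle f g vs = 0"
  using assms
proof (induction "length vs" arbitrary: vs f g p q)
  case (Suc n)
  obtain v us where vs: "vs = v # us" "length us = n" using Suc.hyps(2) by (cases vs) auto
  have rec: "shuffle f g (w # ws) = 0" if "\<not> distinct ws" "length ws = n" for w ws
  proof -
    have "shuffle (\<lambda>xs. f (w # xs)) g ws = 0"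
      by (rule Suc.hyps(1)[OF that(2)[symmetric] alternating_contract[OF Suc.prems(1)] Suc.prems(2) that(1)])
    moreover have "shuffle f (\<lambda>xs. g (w # xs)) ws = 0"
      by (rule Suc.hyps(1)[OF that(2)[symmetric] Suc.prems(1) alternating_contract[OF Suc.prems(2)] that(1)])
    ultimately show ?thesis unfolding shuffle_Cons[OF Suc.prems(1)] by simp
  qed
  show ?case
  proof (cases "distinct us")
    case False
    then show ?thesis using vs by (simp add: rec)
  next
    case True
    then have v: "v \<in> set us" using Suc.prems vs by simp
    then obtain u us' where us: "us = u # us'" by (cases us) auto
    show ?thesis
    proof (cases "v = u")
      case True
      then show ?thesis
        using shuffle_swap_head[OF Suc.prems(1,2), of v v us']
        unfolding eq_neg_iff_add_eq_0 by (simp add: vs us)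
    next
      case False
      then have "\<not> distinct (v # us')" using v us by simp
      then show ?thesis
        using rec[of "v # us'" u] shuffle_swap_head[OF Suc.prems(1,2), of v u us'] vs us by simp
    qed
  qed
qed simp

lemma complex_linear_shuffle:
  assumes "alternating sc p f" "alternating sc q g" "i < length vs"
  shows "complex_linear sc (\<lambda>x. shuffle f g (vs[i := x]))"
  using assms
proof (induction vs arbitrary: f g p q i)
  case (Cons v vs)
  note f = Cons.prems(1) and g = Cons.prems(2)
  show ?case
  proof (cases i)
    case 0
    have "complex_linear sc (\<lambda>x. shuffle (\<lambda>xs. f (x # xs)) g vs)"
      unfolding shuffle_def by (intro complex_linear_sum complex_linear_multc complex_linear_cmult alternating_complex_linear_head[OF f])
    moreover have "complex_linear sc (\<lambda>x. shuffle f (\<lambda>xs. g (x # xs)) vs)"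
      unfolding shuffle_def by (intro complex_linear_sum complex_linear_cmult alternating_complex_linear_head[OF g])
    ultimately show ?thesis
      unfolding 0 list_update_code shuffle_Cons[OF f] by (intro complex_linear_add complex_linear_cmult)
  next
    case (Suc k)
    then have k: "k < length vs" using Cons.prems(3) by simp
    show ?thesis
      unfolding Suc list_update_code shuffle_Cons[OF f]
      by (intro complex_linear_add complex_linear_cmult Cons.IH[OF alternating_contract[OF f] g k]
            Cons.IH[OF f alternating_contract[OF g] k])
  qed
qed simp

lemma length_nths_split: "length (nths vs I) + length (nths vs (- I)) = length vs"
proof -
  have "{i. i < length vs \<and> i \<in> I} \<union> {i. i < length vs \<and> i \<in> - I} = {..<length vs}" by auto
  then show ?thesis
    unfolding length_nths by (subst card_Un_disjoint[symmetric]) auto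
qed

lemma alternating_shuffle:
  assumes f: "alternating sc p f" and g: "alternating sc q g"
  shows "alternating sc (p + q) (shuffle f g)"
  unfolding alternating_def
proof (intro conjI allI impI)
  fix vs :: "'a list" assume len: "length vs \<noteq> p + q"
  show "shuffle f g vs = 0"
    unfolding shuffle_def
  proof (rule sum.neutral, rule ballI)
    fix I
    have "length (nths vs I) \<noteq> p \<or> length (nths vs (- I)) \<noteq> q"
      using len length_nths_split[of vs I] by auto
    then show "(-1) ^ inversions I * f (nths vs I) * g (nths vs (- I)) = 0"
      using alternating_length[OF f] alternating_length[OF g] by auto
  qed
qed (use assms shuffle_not_distinct complex_linear_shuffle in blast)+

section \<open>Real forms and their products\<close>

lemma sesq_eq_0_iff [simp]: "sesq p \<alpha> vs ws = 0 \<longleftrightarrow> \<alpha> vs ws = 0"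
  by (simp add: sesq_def)

lemma form_eq_sesq: "\<alpha> vs ws = \<i> ^ p\<^sup>2 * sesq p \<alpha> vs ws"
  by (simp add: sesq_def)

text \<open>
  For a Hermitian form the conditions on the second group of arguments follow from those on the first.
\<close>

lemma real_forms_iff:
  assumes "vector_space sc"
  shows "\<alpha> \<in> real_forms sc p \<longleftrightarrow>
    (\<forall>ws. alternating sc p (\<lambda>vs. \<alpha> vs ws)) \<and> (\<forall>vs ws. sesq p \<alpha> ws vs = cnj (sesq p \<alpha> vs ws))"
    (is "_ \<longleftrightarrow> ?A \<and> ?H")
proof
  assume \<alpha>: "\<alpha> \<in> real_forms sc p"
  then have F: "\<alpha> \<in> forms sc p p" and H: ?H unfolding real_forms_def by blast+
  have z: "\<alpha> vs ws = 0" if "\<not> (length vs = p \<and> length ws = p)" for vs ws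
    using F that by (auto simp: forms_def)
  have "complex_linear sc (\<lambda>x. \<alpha> (vs[i := x]) ws)" if "i < length vs" for vs ws i
  proof (cases "length vs = p \<and> length ws = p")
    case True
    then show ?thesis using F that linear_iff_complex_linear[OF assms] by (auto simp: forms_def)
  next
    case False
    then have "(\<lambda>x. \<alpha> (vs[i := x]) ws) = (\<lambda>x. 0)" using z by auto
    then show ?thesis by simp
  qed
  moreover have "\<alpha> vs ws = 0" if "\<not> distinct vs" for vs ws
    using F that z[of vs ws] by (cases "length vs = p \<and> length ws = p") (auto simp: forms_def)
  ultimately have ?A using z by (auto simp: alternating_def)
  then show "?A \<and> ?H" using H by blast
next
  assume *: "?A \<and> ?H"
  then have A: "alternating sc p (\<lambda>vs. \<alpha> vs ws)" and H: "sesq p \<alpha> ws vs = cnj (sesq p \<alpha> vs ws)" for vs ws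
    by blast+
  have z0: "\<alpha> ws vs = 0" if "\<alpha> vs ws = 0" for vs ws
    using H[of ws vs] that by (simp add: sesq_def)
  have "antilinear sc (\<lambda>y. \<alpha> vs (ws[j := y]))" if "j < length ws" for vs ws j
  proof -
    have "complex_linear sc (\<lambda>y. \<alpha> (ws[j := y]) vs)" using alternating_complex_linear[OF A that] .
    moreover have "\<alpha> vs (ws[j := y]) = \<i> ^ p\<^sup>2 * cnj (\<alpha> (ws[j := y]) vs / \<i> ^ p\<^sup>2)" for y
      using H[of vs "ws[j := y]"] by (simp add: sesq_def field_simps)
    ultimately show ?thesis
      by (auto simp: antilinear_def complex_linear_def add_divide_distrib algebra_simps)
  qed
  moreover have "\<alpha> vs ws = 0" if "length vs \<noteq> p \<or> length ws \<noteq> p" for vs ws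
    using that alternating_length[OF A] z0 by blast
  moreover have "\<alpha> vs ws = 0" if "\<not> distinct vs \<or> \<not> distinct ws" for vs ws
    using that alternating_distinct[OF A] z0 by blast
  ultimately have "\<alpha> \<in> forms sc p p"
    using alternating_complex_linear[OF A] linear_iff_complex_linear[OF assms] by (auto simp: forms_def)
  then show "\<alpha> \<in> real_forms sc p" using H unfolding real_forms_def by blast
qed

definition supported :: "nat \<Rightarrow> 'v form \<Rightarrow> bool" where
  "supported p \<alpha> \<longleftrightarrow> (\<forall>vs ws. \<alpha> vs ws \<noteq> 0 \<longrightarrow> length vs = p \<and> length ws = p)"

lemma real_forms_supported: "\<alpha> \<in> real_forms sc p \<Longrightarrow> supported p \<alpha>"
  unfolding real_forms_def forms_def supported_def by blast

lemma real_forms_alternating: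
  "vector_space sc \<Longrightarrow> \<alpha> \<in> real_forms sc p \<Longrightarrow> alternating sc p (\<lambda>vs. \<alpha> vs ws)"
  using real_forms_iff by blast

lemma real_forms_hermitian:
  "\<alpha> \<in> real_forms sc p \<Longrightarrow> sesq p \<alpha> ws vs = cnj (sesq p \<alpha> vs ws)"
  unfolding real_forms_def by blast

text \<open>
  The normalization of \<open>sesq\<close> absorbs the sign that arises when the antilinear arguments of the first
  factor pass the linear arguments of the second. In \<open>sesq_wedge\<close> this leaves the signs of the two
  shuffles only, which cancel whenever \<open>I = J\<close>.
\<close>

lemma i_power_sum_square: "\<i> ^ (p + q)\<^sup>2 = (-1) ^ (p * q) * \<i> ^ p\<^sup>2 * \<i> ^ q\<^sup>2"
proof -
  have "\<i> ^ (2 * (p * q)) = (-1) ^ (p * q)" by (simp only: power_mult) simp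
  moreover have "(p + q)\<^sup>2 = 2 * (p * q) + p\<^sup>2 + q\<^sup>2" by (simp add: power2_sum)
  ultimately show ?thesis by (simp only: power_add)
qed

lemma sesq_wedge:
  assumes \<alpha>: "supported p \<alpha>" and \<beta>: "supported q \<beta>"
  shows "sesq (p + q) (\<alpha> \<and>\<and> \<beta>) vs ws =
    (\<Sum>I\<in>Pow {..<length vs}. \<Sum>J\<in>Pow {..<length ws}. (-1) ^ (inversions I + inversions J) *
       sesq p \<alpha> (nths vs I) (nths ws J) * sesq q \<beta> (nths vs (- I)) (nths ws (- J)))"
  unfolding sesq_def[of "p + q"] wedge_def sum_divide_distrib
proof (intro sum.cong refl)
  fix I J assume I: "I \<in> Pow {..<length vs}" and J: "J \<in> Pow {..<length ws}"
  show "(-1) ^ (inversions I + inversions J + card J * card ({..<length vs} - I)) *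
        \<alpha> (nths vs I) (nths ws J) * \<beta> (nths vs (- I)) (nths ws (- J)) / \<i> ^ (p + q)\<^sup>2 =
      (-1) ^ (inversions I + inversions J) *
       sesq p \<alpha> (nths vs I) (nths ws J) * sesq q \<beta> (nths vs (- I)) (nths ws (- J))"
  proof (cases "\<alpha> (nths vs I) (nths ws J) = 0 \<or> \<beta> (nths vs (- I)) (nths ws (- J)) = 0")
    case False
    then have "card J = p" "card ({..<length vs} - I) = q"
      using \<alpha> \<beta> J length_nths_lessThan[of J ws] length_nths_compl[of vs I]
      by (auto simp: supported_def)
    then show ?thesis
      by (simp add: i_power_sum_square power_add sesq_def[of p] sesq_def[of q] field_simps power_mult_distrib[symmetric])
  qed auto
qed

lemma supported_wedge:
  assumes \<alpha>: "supported p \<alpha>" and \<beta>: "supported q \<beta>"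
  shows "supported (p + q) (\<alpha> \<and>\<and> \<beta>)"
  unfolding supported_def
proof (intro allI impI)
  fix vs ws assume "(\<alpha> \<and>\<and> \<beta>) vs ws \<noteq> 0"
  then obtain I J where "\<alpha> (nths vs I) (nths ws J) \<noteq> 0" "\<beta> (nths vs (- I)) (nths ws (- J)) \<noteq> 0"
    unfolding wedge_def by (metis (no_types, lifting) mult_eq_0_iff sum.neutral)
  then show "length vs = p + q \<and> length ws = p + q"
    using \<alpha> \<beta> length_nths_split[of vs I] length_nths_split[of ws J] unfolding supported_def by metis
qed

lemma wedge_real_forms:
  assumes "vector_space sc" and \<alpha>: "\<alpha> \<in> real_forms sc p" and \<beta>: "\<beta> \<in> real_forms sc q"
  shows "\<alpha> \<and>\<and> \<beta> \<in> real_forms sc (p + q)"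
  unfolding real_forms_iff[OF assms(1)]
proof (intro conjI allI)
  note s\<alpha> = real_forms_supported[OF \<alpha>] and s\<beta> = real_forms_supported[OF \<beta>]
  note a = real_forms_alternating[OF assms(1) \<alpha>] real_forms_hermitian[OF \<alpha>]
    and b = real_forms_alternating[OF assms(1) \<beta>] real_forms_hermitian[OF \<beta>]
  fix ws :: "'a list"
  have "(\<alpha> \<and>\<and> \<beta>) vs ws = (\<Sum>J\<in>Pow {..<length ws}. (\<i> ^ (p + q)\<^sup>2 / \<i> ^ p\<^sup>2 / \<i> ^ q\<^sup>2 * (-1) ^ inversions J) *
      shuffle (\<lambda>vs. \<alpha> vs (nths ws J)) (\<lambda>vs. \<beta> vs (nths ws (- J))) vs)" for vs
    unfolding form_eq_sesq[of "\<alpha> \<and>\<and> \<beta>" _ _ "p + q"] sesq_wedge[OF s\<alpha> s\<beta>] shuffle_def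
    by (subst sum.swap) (simp add: sum_distrib_left sum_divide_distrib power_add sesq_def field_simps)
  then show "alternating sc (p + q) (\<lambda>vs. (\<alpha> \<and>\<and> \<beta>) vs ws)"
    by (simp only:) (intro alternating_sum alternating_cmult alternating_shuffle a b)
  fix vs :: "'a list"
  have "cnj (sesq (p + q) (\<alpha> \<and>\<and> \<beta>) vs ws) =
    (\<Sum>I\<in>Pow {..<length vs}. \<Sum>J\<in>Pow {..<length ws}. (-1) ^ (inversions I + inversions J) *
       sesq p \<alpha> (nths ws J) (nths vs I) * sesq q \<beta> (nths ws (- J)) (nths vs (- I)))"
    unfolding sesq_wedge[OF s\<alpha> s\<beta>] by (simp add: a(2)[symmetric] b(2)[symmetric])
  also have "\<dots> = sesq (p + q) (\<alpha> \<and>\<and> \<beta>) ws vs"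
    unfolding sesq_wedge[OF s\<alpha> s\<beta>] by (subst sum.swap) (simp add: add.commute)
  finally show "sesq (p + q) (\<alpha> \<and>\<and> \<beta>) ws vs = cnj (sesq (p + q) (\<alpha> \<and>\<and> \<beta>) vs ws)" by simp
qed

lemma unit_form_real: "vector_space sc \<Longrightarrow> unit_form \<in> real_forms sc 0"
  by (auto simp: real_forms_iff alternating_def unit_form_def sesq_def)

lemma wpow_real: "vector_space sc \<Longrightarrow> \<omega> \<in> real_forms sc 1 \<Longrightarrow> wpow \<omega> n \<in> real_forms sc n"
  using wedge_real_forms[of sc \<omega> 1 _ ] by (induction n) (auto simp: unit_form_real)

lemma sesq_add: "sesq p (\<alpha> + \<beta>) vs ws = sesq p \<alpha> vs ws + sesq p \<beta> vs ws"
  by (simp add: sesq_def add_divide_distrib)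

lemma sesq_rscale: "sesq p (rscale r \<alpha>) vs ws = r * sesq p \<alpha> vs ws"
  by (simp add: sesq_def rscale_def cscale_def)

lemma real_forms_add:
  assumes "vector_space sc" and \<alpha>: "\<alpha> \<in> real_forms sc p" and \<beta>: "\<beta> \<in> real_forms sc p"
  shows "\<alpha> + \<beta> \<in> real_forms sc p"
  unfolding real_forms_iff[OF assms(1)]
proof (intro conjI allI)
  fix vs ws
  show "alternating sc p (\<lambda>vs. (\<alpha> + \<beta>) vs ws)"
    unfolding plus_fun_apply
    by (intro alternating_add real_forms_alternating[OF assms(1)] \<alpha> \<beta>)
  show "sesq p (\<alpha> + \<beta>) ws vs = cnj (sesq p (\<alpha> + \<beta>) vs ws)"
    unfolding sesq_add real_forms_hermitian[OF \<alpha>, of ws vs] real_forms_hermitian[OF \<beta>, of ws vs]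
    by simp
qed

lemma real_forms_zero: "vector_space sc \<Longrightarrow> 0 \<in> real_forms sc p"
  by (simp add: real_forms_iff sesq_def)

lemma real_forms_rscale:
  assumes "vector_space sc" and \<alpha>: "\<alpha> \<in> real_forms sc p"
  shows "rscale r \<alpha> \<in> real_forms sc p"
  unfolding real_forms_iff[OF assms(1)]
proof (intro conjI allI)
  fix vs ws
  show "alternating sc p (\<lambda>vs. rscale r \<alpha> vs ws)"
    unfolding rscale_def cscale_def
    by (intro alternating_cmult real_forms_alternating[OF assms(1)] \<alpha>)
  show "sesq p (rscale r \<alpha>) ws vs = cnj (sesq p (rscale r \<alpha>) vs ws)"
    unfolding sesq_rscale real_forms_hermitian[OF \<alpha>, of ws vs] by simp
qed

lemma real_forms_sum:
  "vector_space sc \<Longrightarrow> (\<And>i. i \<in> A \<Longrightarrow> f i \<in> real_forms sc p) \<Longrightarrow> sum f A \<in> real_forms sc p"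
  by (induction A rule: infinite_finite_induct) (auto intro: real_forms_add real_forms_zero)

lemma sum_form_apply: "(sum f A :: 'v form) vs ws = (\<Sum>i\<in>A. f i vs ws)"
  by (induction A rule: infinite_finite_induct) auto

section \<open>Forms of top degree\<close>

locale complex_basis = vector_space scale
  for scale :: "complex \<Rightarrow> 'v::ab_group_add \<Rightarrow> 'v" +
  fixes bs :: "'v list"
  assumes distinct_bs: "distinct bs" and indep_bs: "\<not> dependent (set bs)" and span_bs: "span (set bs) = UNIV"
begin

abbreviation "d \<equiv> length bs"

text \<open>
  A transposition that puts one more entry in its place changes only the sign of \<open>f\<close>.
\<close>

lemma alternating_permuted_zero:
  assumes f: "alternating scale d f" and f0: "f bs = 0"
    and us: "distinct us" "set us = set bs"
  shows "f us = 0"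
  using us
proof (induction "card {i. i < d \<and> us ! i \<noteq> bs ! i}" arbitrary: us rule: less_induct)
  case less
  have len: "length us = d"
    using less.prems distinct_bs by (metis distinct_card)
  show ?case
  proof (cases "us = bs")
    case False
    then obtain i where i: "i < d" "us ! i \<noteq> bs ! i" using len by (auto simp: list_eq_iff_nth_eq)
    have "bs ! i \<in> set us" using less.prems i by simp
    then obtain j where j: "j < d" "us ! j = bs ! i" using len by (auto simp: in_set_conv_nth)
    have ij: "i \<noteq> j" using i j by auto
    have bj: "us ! j \<noteq> bs ! j" using i j ij distinct_bs by (metis nth_eq_iff_index_eq)
    \<comment> \<open>After the transposition of \<open>i\<close> and \<open>j\<close>, position \<open>i\<close> agrees with \<open>bs\<close> and no agreement is lost.\<close>
    define us' where "us' = us[i := us ! j, j := us ! i]"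
    have "{k. k < d \<and> us' ! k \<noteq> bs ! k} \<subseteq> {k. k < d \<and> us ! k \<noteq> bs ! k} - {i}"
      using i j ij bj len by (auto simp: us'_def nth_list_update split: if_splits)
    then have "card {k. k < d \<and> us' ! k \<noteq> bs ! k} < card {k. k < d \<and> us ! k \<noteq> bs ! k}"
      using i by (intro psubset_card_mono) auto
    moreover have "distinct us'" "set us' = set bs"
      unfolding us'_def using less.prems i(1) j(1) len by (simp_all only: distinct_swap set_swap)
    ultimately have "f us' = 0" using less.hyps by blast
    moreover have "f us' = - f us"
    proof -
      have "us[i := us ! i, j := us ! j] = us" by simp
      then show ?thesis
        unfolding us'_def using alternating_swap[OF f, of i us j "us ! j" "us ! i"] i(1) j(1) ij len by simp
    qed
    ultimately show ?thesis by simp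
  qed (use f0 in simp)
qed

text \<open>
  This is the fact that \<open>\<Lambda>\<^sup>d V\<close> is a line when \<open>d = dim V\<close>. The entries are expanded in the basis one after
  the other; at stage \<open>k\<close> all entries from position \<open>k\<close> on are basis vectors.
\<close>

lemma alternating_eq_zero:
  assumes f: "alternating scale d f" and f0: "f bs = 0"
  shows "f vs = 0"
proof -
  have "f vs = 0" if "length vs = d" "set (drop k vs) \<subseteq> set bs" "k \<le> d" for k vs
    using that
  proof (induction k arbitrary: vs)
    case 0
    show ?case
    proof (cases "distinct vs")
      case True
      then have "set vs = set bs"
        using 0 distinct_bs by (intro card_subset_eq) (auto simp: distinct_card)
      then show ?thesis using alternating_permuted_zero[OF f f0 True] by simp
    qed (use alternating_distinct[OF f] in auto)
  next
    case (Suc k)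
    have k: "k < length vs" using Suc.prems by simp
    have "vs ! k = (\<Sum>b\<in>set bs. scale (representation (set bs) (vs ! k) b) b)"
      using sum_representation_eq[OF indep_bs, of "vs ! k" "set bs"] span_bs by simp
    then have "f vs = f (vs[k := (\<Sum>b\<in>set bs. scale (representation (set bs) (vs ! k) b) b)])"
      by (metis list_update_id)
    also have "\<dots> = (\<Sum>b\<in>set bs. representation (set bs) (vs ! k) b * f (vs[k := b]))"
      by (rule complex_linear_apply_sum[OF alternating_complex_linear[OF f k]])
    also have "\<dots> = 0"
    proof (intro sum.neutral ballI)
      fix b assume b: "b \<in> set bs"
      have "drop k (vs[k := b]) = b # drop (Suc k) vs"
        using k by (simp add: drop_update_swap Cons_nth_drop_Suc[symmetric])
      then show "representation (set bs) (vs ! k) b * f (vs[k := b]) = 0"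
        using Suc.IH[of "vs[k := b]"] Suc.prems b by simp
    qed
    finally show ?case .
  qed
  from this[of vs d] show ?thesis
    using alternating_length[OF f, of vs] by (cases "length vs = d") auto
qed

lemma top_form_eq_zero:
  assumes \<beta>: "\<beta> \<in> real_forms scale d" and "\<beta> bs bs = 0"
  shows "\<beta> = 0"
proof -
  note a = real_forms_alternating[OF vector_space_axioms \<beta>] and h = real_forms_hermitian[OF \<beta>]
  have "\<beta> vs bs = 0" for vs using alternating_eq_zero[OF a assms(2)] .
  then have "\<beta> bs vs = 0" for vs using h[of vs bs] by (simp add: sesq_def)
  then have "\<beta> vs ws = 0" for vs ws using alternating_eq_zero[OF a] by blast
  then show ?thesis by (intro ext) simp
qed

text \<open>
  Both sides are the value at \<open>vs = ws\<close> of alternating functions of \<open>vs\<close> that agree at \<open>bs\<close>. As a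
  consequence the sign of a real top form does not depend on the basis at which it is evaluated.
\<close>

lemma top_form_sesq_square:
  assumes \<beta>: "\<beta> \<in> real_forms scale d"
  shows "sesq d \<beta> ws ws * sesq d \<beta> bs bs = sesq d \<beta> ws bs * cnj (sesq d \<beta> ws bs)"
proof -
  note a = real_forms_alternating[OF vector_space_axioms \<beta>] and h = real_forms_hermitian[OF \<beta>]
  define f where "f vs = sesq d \<beta> bs bs * \<beta> vs ws + (- sesq d \<beta> bs ws) * \<beta> vs bs" for vs
  have "f ws = 0"
  proof (rule alternating_eq_zero)
    show "alternating scale d f" unfolding f_def by (intro alternating_add alternating_cmult a)
    show "f bs = 0" by (simp add: f_def sesq_def)
  qed
  then show ?thesis using h[of bs ws] by (simp add: f_def sesq_def field_simps)
qed

text \<open>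
  Real top forms are a real line. A generator \<open>\<beta>0\<close> with value \<open>1\<close> at the basis is obtained from the
  surjectivity of \<open>L\<close>; it is positive by \<open>top_form_sesq_square\<close>, so \<open>\<kappa> = L \<beta>0\<close> is positive.
\<close>

lemma integral_eq_value_on_basis:
  assumes L: "positive_integral scale d L"
  obtains \<kappa> where "\<kappa> > 0" "\<And>\<beta>. \<beta> \<in> real_forms scale d \<Longrightarrow> L \<beta> = \<kappa> * Re (sesq d \<beta> bs bs)"
proof -
  note vs = vector_space_axioms
  have scl: "L (rscale r \<alpha>) = r * L \<alpha>" if "\<alpha> \<in> real_forms scale d" for r \<alpha>
    using L that by (auto simp: positive_integral_def)
  have add: "L (\<alpha> + \<beta>) = L \<alpha> + L \<beta>" if "\<alpha> \<in> real_forms scale d" "\<beta> \<in> real_forms scale d" for \<alpha> \<beta>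
    using L that by (auto simp: positive_integral_def)
  have im: "sesq d \<beta> bs bs = complex_of_real (Re (sesq d \<beta> bs bs))" if "\<beta> \<in> real_forms scale d" for \<beta>
    using real_forms_hermitian[OF that, of bs bs] by (simp add: complex_eq_iff)
  have "L ` real_forms scale d = UNIV"
    using L by (simp add: positive_integral_def bij_betw_def)
  then obtain \<beta>1 where \<beta>1: "\<beta>1 \<in> real_forms scale d" "L \<beta>1 = 1" by (metis UNIV_I imageE)
  define r where "r = Re (sesq d \<beta>1 bs bs)"
  have L0: "L 0 = 0" using add[of 0 0] real_forms_zero[OF vs] by simp
  have "r \<noteq> 0"
  proof
    assume "r = 0"
    then have "\<beta>1 bs bs = 0" using im[OF \<beta>1(1)] by (simp add: r_def)
    then have "\<beta>1 = 0" using top_form_eq_zero \<beta>1 by blast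
    then show False using \<beta>1 L0 by simp
  qed
  define \<beta>0 where "\<beta>0 = rscale (1 / r) \<beta>1"
  have \<beta>0: "\<beta>0 \<in> real_forms scale d" unfolding \<beta>0_def by (rule real_forms_rscale[OF vs \<beta>1(1)])
  have \<beta>0bs: "sesq d \<beta>0 bs bs = 1"
    using im[OF \<beta>1(1)] \<open>r \<noteq> 0\<close> unfolding \<beta>0_def sesq_rscale r_def[symmetric] by simp
  have "positive_top_form scale d \<beta>0"
    unfolding positive_top_form_def
  proof (intro conjI allI impI \<beta>0)
    fix ws :: "'v list" assume ws: "length ws = d" "distinct ws" "\<not> dependent (set ws)"
    have sp: "span (set ws) = UNIV"
    proof (rule ccontr)
      assume "span (set ws) \<noteq> UNIV"
      then obtain v where v: "v \<notin> span (set ws)" by auto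
      then have "\<not> dependent (insert v (set ws))" using ws independent_insertI by blast
      from independent_span_bound[OF _ this, of "set bs"] span_bs
      have "card (insert v (set ws)) \<le> card (set bs)" by simp
      moreover have "v \<notin> set ws" using v span_base by blast
      ultimately show False using ws distinct_bs by (simp add: distinct_card)
    qed
    interpret w: complex_basis scale ws by unfold_locales (use ws sp in auto)
    have "sesq d \<beta>0 ws bs \<noteq> 0"
    proof
      assume "sesq d \<beta>0 ws bs = 0"
      then have "\<beta>0 ws bs = 0" by simp
      moreover have "alternating scale (length ws) (\<lambda>vs. \<beta>0 vs bs)"
        using real_forms_alternating[OF vs \<beta>0] ws by simp
      ultimately have "\<beta>0 bs bs = 0" using w.alternating_eq_zero by blast
      then show False using \<beta>0bs by (simp add: sesq_def)
    qed
    then show "Re (sesq d \<beta>0 ws ws) > 0"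
      using top_form_sesq_square[OF \<beta>0, of ws] \<beta>0bs
      by (simp add: complex_mult_cnj complex_eq_iff sum_power2_gt_zero_iff)
  qed
  then have pos: "L \<beta>0 > 0" using L by (simp add: positive_integral_def)
  have "L \<beta> = L \<beta>0 * Re (sesq d \<beta> bs bs)" if \<beta>: "\<beta> \<in> real_forms scale d" for \<beta>
  proof -
    define s where "s = Re (sesq d \<beta> bs bs)"
    define \<gamma> where "\<gamma> = \<beta> + rscale (- s) \<beta>0"
    have \<gamma>: "\<gamma> \<in> real_forms scale d" unfolding \<gamma>_def by (intro real_forms_add real_forms_rscale vs \<beta> \<beta>0)
    have "sesq d \<gamma> bs bs = sesq d \<beta> bs bs - s * sesq d \<beta>0 bs bs"
      by (simp add: \<gamma>_def sesq_add sesq_rscale)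
    then have "\<gamma> bs bs = 0" using im[OF \<beta>] \<beta>0bs by (simp add: s_def[symmetric])
    then have "\<gamma> = 0" using top_form_eq_zero \<gamma> by blast
    then have "L \<gamma> = 0" using L0 by simp
    moreover have "L \<gamma> = L \<beta> + (- s) * L \<beta>0"
      unfolding \<gamma>_def using add[OF \<beta> real_forms_rscale[OF vs \<beta>0]] scl[OF \<beta>0] by metis
    ultimately show ?thesis by (simp add: s_def)
  qed
  with pos that show ?thesis by blast
qed

end

section \<open>Products of diagonal forms\<close>

text \<open>
  Integrating the derivative of \<open>t ^ (a + 1) * (1 - t) ^ (b + 1)\<close> relates the exponents \<open>(a, b + 1)\<close> and
  \<open>(a + 1, b)\<close>.
\<close>

lemma integral_beta:
  "((\<lambda>t::real. t ^ a * (1 - t) ^ b) has_integral (fact a * fact b / fact (a + b + 1))) {0..1}"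
proof (induction b arbitrary: a)
  case 0
  have "((\<lambda>t::real. t ^ a) has_integral (1 ^ Suc a / real (Suc a) - 0 ^ Suc a / real (Suc a))) {0..1}"
  proof (rule fundamental_theorem_of_calculus)
    fix t :: real
    have "((\<lambda>t. t ^ Suc a / real (Suc a)) has_real_derivative t ^ a) (at t within {0..1})"
      using DERIV_cdivide[OF DERIV_pow[of "Suc a" t "{0..1}"], of "real (Suc a)"] by (simp del: power_Suc of_nat_Suc)
    then show "((\<lambda>t. t ^ Suc a / real (Suc a)) has_vector_derivative t ^ a) (at t within {0..1})"
      by (simp only: has_real_derivative_iff_has_vector_derivative)
  qed simp
  moreover have "fact a * fact 0 / fact (a + 0 + 1) = (1 ^ Suc a / real (Suc a) - 0 ^ Suc a / real (Suc a))"
    by (simp del: of_nat_Suc)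
  ultimately show ?case by (simp only: power_0 mult_1_right)
next
  case (Suc b)
  have "((\<lambda>t::real. real (Suc a) * (t ^ a * (1 - t) ^ Suc b) - real (Suc b) * (t ^ Suc a * (1 - t) ^ b)) has_integral
      (1 ^ Suc a * (1 - 1) ^ Suc b - 0 ^ Suc a * (1 - 0) ^ Suc b)) {0..1}"
  proof (rule fundamental_theorem_of_calculus)
    fix t :: real
    have "((\<lambda>t. (1 - t) ^ Suc b) has_real_derivative real (Suc b) * ((0 - 1) * (1 - t) ^ (Suc b - Suc 0))) (at t within {0..1})"
      by (intro DERIV_power DERIV_diff DERIV_const DERIV_ident)
    from DERIV_mult[OF DERIV_pow[of "Suc a" t] this]
    have "((\<lambda>t. t ^ Suc a * (1 - t) ^ Suc b) has_real_derivative
        real (Suc a) * (t ^ a * (1 - t) ^ Suc b) - real (Suc b) * (t ^ Suc a * (1 - t) ^ b)) (at t within {0..1})"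
      by (simp add: algebra_simps del: power_Suc of_nat_Suc)
    then show "((\<lambda>t. t ^ Suc a * (1 - t) ^ Suc b) has_vector_derivative
        real (Suc a) * (t ^ a * (1 - t) ^ Suc b) - real (Suc b) * (t ^ Suc a * (1 - t) ^ b)) (at t within {0..1})"
      by (simp only: has_real_derivative_iff_has_vector_derivative)
  qed simp
  from has_integral_add[OF this has_integral_mult_right[OF Suc.IH[of "Suc a"], of "real (Suc b)"]]
  have "((\<lambda>t::real. real (Suc a) * (t ^ a * (1 - t) ^ Suc b)) has_integral
      real (Suc b) * (fact (Suc a) * fact b / fact (Suc a + b + 1))) {0..1}" by simp
  from has_integral_mult_right[OF this, of "1 / real (Suc a)"]
  have "((\<lambda>t::real. t ^ a * (1 - t) ^ Suc b) has_integral
      1 / real (Suc a) * (real (Suc b) * (fact (Suc a) * fact b / fact (Suc a + b + 1)))) {0..1}"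
    by (simp add: mult.assoc[symmetric] del: of_nat_Suc)
  moreover have "1 / real (Suc a) * (real (Suc b) * (fact (Suc a) * fact b / fact (Suc a + b + 1))) =
      fact a * fact (Suc b) / fact (a + Suc b + 1)"
    by (simp add: field_simps del: of_nat_Suc)
  ultimately show ?case by (simp only:)
qed

lemma integral_prod_pencil:
  assumes "finite S"
  shows "fact (card S + 1) * integral {0..1} (\<lambda>t. \<Prod>i\<in>S. pencil (lam i) t) =
    (\<Sum>A\<in>Pow S. fact (card A) * fact (card (S - A)) * (\<Prod>i\<in>S - A. lam i))"
proof -
  have "((\<lambda>t. \<Sum>A\<in>Pow S. t ^ card A * (1 - t) ^ card (S - A) * (\<Prod>i\<in>S - A. lam i)) has_integral
      (\<Sum>A\<in>Pow S. fact (card A) * fact (card (S - A)) / fact (card A + card (S - A) + 1) * (\<Prod>i\<in>S - A. lam i))) {0..1}"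
    using assms by (intro has_integral_sum has_integral_mult_left integral_beta) auto
  moreover have "(\<Prod>i\<in>S. pencil (lam i) t) =
      (\<Sum>A\<in>Pow S. t ^ card A * (1 - t) ^ card (S - A) * (\<Prod>i\<in>S - A. lam i))" for t
    unfolding pencil_def by (simp add: prod_add[OF assms] prod.distrib mult.assoc)
  ultimately have "integral {0..1} (\<lambda>t. \<Prod>i\<in>S. pencil (lam i) t) =
      (\<Sum>A\<in>Pow S. fact (card A) * fact (card (S - A)) / fact (card A + card (S - A) + 1) * (\<Prod>i\<in>S - A. lam i))"
    by (simp add: integral_unique)
  also have "\<dots> = (\<Sum>A\<in>Pow S. fact (card A) * fact (card (S - A)) / fact (card S + 1) * (\<Prod>i\<in>S - A. lam i))"
  proof (intro sum.cong refl)
    fix A assume A: "A \<in> Pow S"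
    then have "card A + card (S - A) = card S"
      using assms card_mono[OF assms, of A] by (simp add: card_Diff_subset finite_subset)
    then show "fact (card A) * fact (card (S - A)) / fact (card A + card (S - A) + 1) * (\<Prod>i\<in>S - A. lam i) =
        fact (card A) * fact (card (S - A)) / fact (card S + 1) * (\<Prod>i\<in>S - A. lam i)"
      by (simp only:)
  qed
  finally show ?thesis by (simp add: sum_distrib_left)
qed

text \<open>
  In coordinates: \<open>\<alpha>\<close> is a combination with coefficients \<open>c S\<close> of the products over \<open>i \<in> S\<close> of the
  forms \<open>\<i> dz\<^sub>i \<and> d(cnj z\<^sub>i)\<close>, for \<open>S\<close> a set of \<open>p\<close> elements of the basis \<open>B\<close>. Since both argument
  lists can be taken to be the same list, no signs of permutations enter.
\<close>

definition diagonal_on :: "'v set \<Rightarrow> nat \<Rightarrow> 'v form \<Rightarrow> ('v set \<Rightarrow> real) \<Rightarrow> bool" where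
  "diagonal_on B p \<alpha> c \<longleftrightarrow> supported p \<alpha> \<and>
     (\<forall>vs. distinct vs \<longrightarrow> set vs \<subseteq> B \<longrightarrow> length vs = p \<longrightarrow> sesq p \<alpha> vs vs = c (set vs)) \<and>
     (\<forall>vs ws. distinct vs \<longrightarrow> distinct ws \<longrightarrow> set vs \<subseteq> B \<longrightarrow> set ws \<subseteq> B \<longrightarrow> set vs \<noteq> set ws \<longrightarrow> \<alpha> vs ws = 0)"

lemma diagonal_on_supported: "diagonal_on B p \<alpha> c \<Longrightarrow> supported p \<alpha>"
  by (simp add: diagonal_on_def)

lemma diagonal_on_diag:
  "diagonal_on B p \<alpha> c \<Longrightarrow> distinct vs \<Longrightarrow> set vs \<subseteq> B \<Longrightarrow> length vs = p \<Longrightarrow> sesq p \<alpha> vs vs = c (set vs)"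
  by (simp add: diagonal_on_def)

lemma diagonal_on_off:
  "diagonal_on B p \<alpha> c \<Longrightarrow> distinct vs \<Longrightarrow> distinct ws \<Longrightarrow> set vs \<subseteq> B \<Longrightarrow> set ws \<subseteq> B \<Longrightarrow>
    set vs \<noteq> set ws \<Longrightarrow> \<alpha> vs ws = 0"
  by (simp add: diagonal_on_def)

lemma diagonal_on_cong:
  assumes "diagonal_on B p \<alpha> c" "\<And>S. S \<subseteq> B \<Longrightarrow> finite S \<Longrightarrow> card S = p \<Longrightarrow> c S = c' S"
  shows "diagonal_on B p \<alpha> c'"
  using assms unfolding diagonal_on_def by (metis List.finite_set distinct_card)

lemma set_nths_image: "I \<subseteq> {..<length vs} \<Longrightarrow> set (nths vs I) = (!) vs ` I"
  unfolding set_nths by auto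

lemma set_nths_compl:
  "distinct vs \<Longrightarrow> I \<subseteq> {..<length vs} \<Longrightarrow> set (nths vs (- I)) = set vs - (!) vs ` I"
proof -
  assume vs: "distinct vs" and I: "I \<subseteq> {..<length vs}"
  have "set (nths vs (- I)) = (!) vs ` ({..<length vs} - I)" unfolding set_nths by auto
  also have "\<dots> = (!) vs ` {..<length vs} - (!) vs ` I"
    using vs I by (intro inj_on_image_set_diff[of _ "{..<length vs}"] inj_on_nth) auto
  also have "(!) vs ` {..<length vs} = set vs" by (auto simp: set_conv_nth)
  finally show ?thesis .
qed

text \<open>
  If one factor is diagonal, the same vectors must be chosen in both groups of arguments, so only the
  terms with \<open>I = J\<close> survive, and these have sign \<open>1\<close>.
\<close>

lemma sesq_wedge_diagonal:
  assumes \<alpha>: "diagonal_on B p \<alpha> a" and \<beta>: "supported q \<beta>" and vs: "distinct vs" "set vs \<subseteq> B"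
  shows "sesq (p + q) (\<alpha> \<and>\<and> \<beta>) vs vs =
    (\<Sum>I\<in>Pow {..<length vs}. sesq p \<alpha> (nths vs I) (nths vs I) * sesq q \<beta> (nths vs (- I)) (nths vs (- I)))"
  unfolding sesq_wedge[OF diagonal_on_supported[OF \<alpha>] \<beta>]
proof (intro sum.cong refl)
  fix I assume I: "I \<in> Pow {..<length vs}"
  let ?t = "\<lambda>J. (-1) ^ (inversions I + inversions J) * sesq p \<alpha> (nths vs I) (nths vs J) *
        sesq q \<beta> (nths vs (- I)) (nths vs (- J))"
  have inj: "inj_on ((!) vs) {..<length vs}" using vs by (simp add: inj_on_nth)
  have "?t J = 0" if "J \<in> Pow {..<length vs} - {I}" for J
  proof -
    have "(!) vs ` I \<noteq> (!) vs ` J"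
      using that I inj by (auto simp: inj_on_image_eq_iff)
    then have "set (nths vs I) \<noteq> set (nths vs J)"
      using I that set_nths_image[of I vs] set_nths_image[of J vs] by simp
    then have "\<alpha> (nths vs I) (nths vs J) = 0"
      using diagonal_on_off[OF \<alpha> distinct_nthsI[OF vs(1)] distinct_nthsI[OF vs(1)]]
        set_nths_subset[THEN subset_trans, OF vs(2)] by blast
    then show ?thesis by simp
  qed
  then have "(\<Sum>J\<in>Pow {..<length vs} - {I}. ?t J) = 0" by (intro sum.neutral ballI)
  then have "(\<Sum>J\<in>Pow {..<length vs}. ?t J) = ?t I"
    by (subst sum.remove[OF _ I]) (simp_all only: finite_Pow_iff finite_lessThan add_0_right)
  also have "\<dots> = sesq p \<alpha> (nths vs I) (nths vs I) * sesq q \<beta> (nths vs (- I)) (nths vs (- I))"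
    by (simp add: power_add power_mult_distrib[symmetric])
  finally show "(\<Sum>J\<in>Pow {..<length vs}. ?t J) =
      sesq p \<alpha> (nths vs I) (nths vs I) * sesq q \<beta> (nths vs (- I)) (nths vs (- I))" .
qed

lemma diagonal_wedge:
  assumes \<alpha>: "diagonal_on B p \<alpha> a" and \<beta>: "diagonal_on B q \<beta> b"
  shows "diagonal_on B (p + q) (\<alpha> \<and>\<and> \<beta>) (\<lambda>S. \<Sum>A | A \<subseteq> S \<and> card A = p. a A * b (S - A))"
  unfolding diagonal_on_def
proof (intro conjI allI impI)
  note s\<alpha> = diagonal_on_supported[OF \<alpha>] and s\<beta> = diagonal_on_supported[OF \<beta>]
  show "supported (p + q) (\<alpha> \<and>\<and> \<beta>)" by (rule supported_wedge[OF s\<alpha> s\<beta>])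
  note sub = set_nths_subset[THEN subset_trans]
  {
    fix vs ws :: "'a list"
    assume vs: "distinct vs" "set vs \<subseteq> B" and ws: "distinct ws" "set ws \<subseteq> B" and ne: "set vs \<noteq> set ws"
    have "sesq (p + q) (\<alpha> \<and>\<and> \<beta>) vs ws = 0"
      unfolding sesq_wedge[OF s\<alpha> s\<beta>]
    proof (intro sum.neutral ballI)
      fix I J assume I: "I \<in> Pow {..<length vs}" and J: "J \<in> Pow {..<length ws}"
      have "set vs = set (nths vs I) \<union> set (nths vs (- I))" "set ws = set (nths ws J) \<union> set (nths ws (- J))"
        unfolding set_nths set_conv_nth[of vs] set_conv_nth[of ws] by blast+
      then have "set (nths vs I) \<noteq> set (nths ws J) \<or> set (nths vs (- I)) \<noteq> set (nths ws (- J))"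
        using ne by metis
      then have "\<alpha> (nths vs I) (nths ws J) = 0 \<or> \<beta> (nths vs (- I)) (nths ws (- J)) = 0"
        using diagonal_on_off[OF \<alpha>, of "nths vs I" "nths ws J"]
          diagonal_on_off[OF \<beta>, of "nths vs (- I)" "nths ws (- J)"]
          distinct_nthsI[OF vs(1)] distinct_nthsI[OF ws(1)] sub[OF vs(2)] sub[OF ws(2)] by blast
      then show "(-1) ^ (inversions I + inversions J) * sesq p \<alpha> (nths vs I) (nths ws J) *
          sesq q \<beta> (nths vs (- I)) (nths ws (- J)) = 0" by auto
    qed
    then show "(\<alpha> \<and>\<and> \<beta>) vs ws = 0" by simp
  }
  fix vs :: "'a list"
  assume vs: "distinct vs" "set vs \<subseteq> B" "length vs = p + q"
  define n where "n = length vs"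
  define h where "h A = (if card A = p then a A * b (set vs - A) else 0)" for A
  have inj: "inj_on ((!) vs) {..<n}" using vs by (simp add: inj_on_nth n_def)
  have "sesq (p + q) (\<alpha> \<and>\<and> \<beta>) vs vs = (\<Sum>I\<in>Pow {..<n}. complex_of_real (h ((!) vs ` I)))"
    unfolding sesq_wedge_diagonal[OF \<alpha> s\<beta> vs(1,2)] n_def[symmetric]
  proof (intro sum.cong refl)
    fix I assume I: "I \<in> Pow {..<n}"
    show "sesq p \<alpha> (nths vs I) (nths vs I) * sesq q \<beta> (nths vs (- I)) (nths vs (- I)) =
        complex_of_real (h ((!) vs ` I))"
    proof (cases "card I = p")
      case True
      have l: "length (nths vs I) = p" "length (nths vs (- I)) = q"
        using True I length_nths_lessThan[of I vs] length_nths_split[of vs I] vs(3) by (auto simp: n_def)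
      have "card ((!) vs ` I) = p"
        using True I inj by (metis PowD card_image inj_on_subset)
      then show ?thesis
        using diagonal_on_diag[OF \<alpha> distinct_nthsI[OF vs(1)] sub[OF vs(2)] l(1)]
          diagonal_on_diag[OF \<beta> distinct_nthsI[OF vs(1)] sub[OF vs(2)] l(2)] vs(1) I
        by (simp add: h_def set_nths_image set_nths_compl n_def)
    next
      case False
      then have "length (nths vs I) \<noteq> p" using I length_nths_lessThan[of I vs] by (simp add: n_def)
      then have "\<alpha> (nths vs I) (nths vs I) = 0" using s\<alpha> unfolding supported_def by blast
      moreover have "card ((!) vs ` I) \<noteq> p"
        using False I inj by (metis PowD card_image inj_on_subset)
      ultimately show ?thesis by (simp add: h_def)
    qed
  qed
  also have "\<dots> = (\<Sum>A\<in>Pow (set vs). complex_of_real (h A))"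
    using vs by (intro sum.reindex_bij_betw bij_betw_Pow bij_betw_nth) (auto simp: n_def)
  also have "\<dots> = complex_of_real (\<Sum>A | A \<subseteq> set vs \<and> card A = p. a A * b (set vs - A))"
    unfolding of_real_sum[symmetric] h_def
    by (simp add: sum.inter_filter[symmetric])
  finally show "sesq (p + q) (\<alpha> \<and>\<and> \<beta>) vs vs =
      complex_of_real (\<Sum>A | A \<subseteq> set vs \<and> card A = p. a A * b (set vs - A))" .
qed

lemma diagonal_unit_form: "diagonal_on B 0 unit_form (\<lambda>S. 1)"
  by (auto simp: diagonal_on_def supported_def unit_form_def sesq_def)

text \<open>
  The factor \<open>fact n\<close> counts the orders in which the \<open>n\<close> elements of \<open>S\<close> are distributed to the factors
  of the power.
\<close>

lemma diagonal_wpow: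
  fixes l :: "'v \<Rightarrow> real"
  assumes "diagonal_on B 1 \<omega> (\<lambda>S. \<Prod>x\<in>S. l x)"
  shows "diagonal_on B n (wpow \<omega> n) (\<lambda>S. fact n * (\<Prod>x\<in>S. l x))"
proof (induction n)
  case 0
  show ?case by (rule diagonal_on_cong[of _ _ _ "\<lambda>S. 1"]) (auto simp: diagonal_unit_form)
next
  case (Suc n)
  have "diagonal_on B (1 + n) (\<omega> \<and>\<and> wpow \<omega> n)
      (\<lambda>S. \<Sum>A | A \<subseteq> S \<and> card A = 1. (\<Prod>x\<in>A. l x) * (fact n * (\<Prod>x\<in>S - A. l x)))"
    by (rule diagonal_wedge[OF assms Suc.IH])
  then have "diagonal_on B (1 + n) (\<omega> \<and>\<and> wpow \<omega> n) (\<lambda>S. fact (1 + n) * (\<Prod>x\<in>S. l x))"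
  proof (rule diagonal_on_cong)
    fix S :: "'v set" assume S: "finite S" "card S = 1 + n"
    have "(\<Sum>A | A \<subseteq> S \<and> card A = 1. (\<Prod>x\<in>A. l x) * (fact n * (\<Prod>x\<in>S - A. l x))) =
        (\<Sum>A | A \<subseteq> S \<and> card A = 1. fact n * (\<Prod>x\<in>S. l x))"
      using S by (intro sum.cong refl) (auto simp: prod.subset_diff[of _ S] mult_ac)
    also have "\<dots> = fact (1 + n) * (\<Prod>x\<in>S. l x)"
      using n_subsets[of S 1] S by simp
    finally show "(\<Sum>A | A \<subseteq> S \<and> card A = 1. (\<Prod>x\<in>A. l x) * (fact n * (\<Prod>x\<in>S - A. l x))) =
      fact (1 + n) * (\<Prod>x\<in>S. l x)" .
  qed
  then show ?case by simp
qed

lemma supported_sum: "(\<And>i. i \<in> A \<Longrightarrow> supported p (f i)) \<Longrightarrow> supported p (sum f A)"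
  unfolding supported_def sum_form_apply by (meson sum.not_neutral_contains_not_neutral)

lemma sesq_sum: "sesq p (sum f A) vs ws = (\<Sum>i\<in>A. sesq p (f i) vs ws)"
  by (simp add: sesq_def sum_form_apply sum_divide_distrib)

lemma diagonal_sum:
  assumes "\<And>i. i \<in> A \<Longrightarrow> diagonal_on B p (f i) (c i)"
  shows "diagonal_on B p (sum f A) (\<lambda>S. \<Sum>i\<in>A. c i S)"
  using assms unfolding diagonal_on_def
  by (auto simp: supported_sum sesq_sum sum_form_apply)

text \<open>
  The term with index \<open>j\<close> contributes the subsets \<open>A\<close> with \<open>m - j\<close> elements, on which \<open>\<omega>1\<close> is evaluated,
  with weight \<open>(m - j)! j!\<close>. Together the terms run through all subsets of \<open>S\<close>, as in
  \<open>integral_prod_pencil\<close>.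
\<close>

lemma diagonal_complete_homogeneous:
  fixes l :: "'v \<Rightarrow> real"
  assumes \<omega>1: "diagonal_on B 1 \<omega>1 (\<lambda>S. 1)" and \<omega>2: "diagonal_on B 1 \<omega>2 (\<lambda>S. \<Prod>x\<in>S. l x)"
  shows "diagonal_on B m (\<Sum>j\<le>m. wpow \<omega>1 (m - j) \<and>\<and> wpow \<omega>2 j)
    (\<lambda>S. fact (m + 1) * integral {0..1} (\<lambda>t. \<Prod>i\<in>S. pencil (l i) t))"
proof -
  have 1: "diagonal_on B k (wpow \<omega>1 k) (\<lambda>S. fact k * (\<Prod>x\<in>S. 1))" for k
    using \<omega>1 by (intro diagonal_wpow) simp
  have "diagonal_on B m (wpow \<omega>1 (m - j) \<and>\<and> wpow \<omega>2 j)
      (\<lambda>S. \<Sum>A | A \<subseteq> S \<and> card A = m - j. (fact (m - j) * (\<Prod>x\<in>A. 1)) * (fact j * (\<Prod>x\<in>S - A. l x)))"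
    if "j \<in> {..m}" for j
    using diagonal_wedge[OF 1[of "m - j"] diagonal_wpow[OF \<omega>2, of j]] that by simp
  from diagonal_sum[OF this]
  have "diagonal_on B m (\<Sum>j\<le>m. wpow \<omega>1 (m - j) \<and>\<and> wpow \<omega>2 j)
      (\<lambda>S. \<Sum>j\<le>m. \<Sum>A | A \<subseteq> S \<and> card A = m - j. (fact (m - j) * (\<Prod>x\<in>A. 1)) * (fact j * (\<Prod>x\<in>S - A. l x)))" .
  then show ?thesis
  proof (rule diagonal_on_cong)
    fix S :: "'v set" assume S: "finite S" "card S = m"
    let ?g = "\<lambda>A. fact (card A) * fact (card (S - A)) * (\<Prod>i\<in>S - A. l i)"
    have "(\<Sum>j\<le>m. \<Sum>A | A \<subseteq> S \<and> card A = m - j. (fact (m - j) * (\<Prod>x\<in>A. 1)) * (fact j * (\<Prod>x\<in>S - A. l x))) =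
        (\<Sum>j\<le>m. \<Sum>A\<in>{A \<in> Pow S. m - card A = j}. ?g A)"
    proof (intro sum.cong)
      fix j assume j: "j \<in> {..m}"
      show "{A. A \<subseteq> S \<and> card A = m - j} = {A \<in> Pow S. m - card A = j}"
        using S j card_mono[of S] by auto
      fix A assume "A \<in> {A \<in> Pow S. m - card A = j}"
      then have A: "A \<subseteq> S" "m - card A = j" by auto
      then have "card A = m - j" "card (S - A) = j"
        using S card_mono[of S A] by (auto simp: card_Diff_subset finite_subset)
      then show "fact (m - j) * (\<Prod>x\<in>A. 1) * (fact j * (\<Prod>x\<in>S - A. l x)) = ?g A" by simp
    qed simp
    also have "\<dots> = (\<Sum>A\<in>Pow S. ?g A)"
      using S by (intro sum.group) auto
    also have "\<dots> = fact (m + 1) * integral {0..1} (\<lambda>t. \<Prod>i\<in>S. pencil (l i) t)"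
      using integral_prod_pencil[OF S(1), of l] S by simp
    finally show "(\<Sum>j\<le>m. \<Sum>A | A \<subseteq> S \<and> card A = m - j. (fact (m - j) * (\<Prod>x\<in>A. 1)) * (fact j * (\<Prod>x\<in>S - A. l x))) =
       fact (m + 1) * integral {0..1} (\<lambda>t. \<Prod>i\<in>S. pencil (l i) t)" .
  qed
qed

section \<open>Expansion of products along a form of type (1, 1)\<close>

lemma distinct_set_singleton: "distinct xs \<Longrightarrow> set xs = {a} \<Longrightarrow> xs = [a]"
proof -
  assume d: "distinct xs" and s: "set xs = {a}"
  then have "length xs = 1" using distinct_card by fastforce
  then obtain b where "xs = [b]" by (auto simp: length_Suc_conv)
  then show ?thesis using s by simp
qed

lemma nths_eq_filter: "distinct vs \<Longrightarrow> nths vs I = filter (\<lambda>x. x \<in> set (nths vs I)) vs"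
  by (simp add: filter_in_nths)

lemma nths_single:
  assumes "distinct vs" "j < length vs"
  shows "nths vs {j} = [vs ! j]" "nths vs (- {j}) = removeAll (vs ! j) vs"
    "nths vs ({..<length vs} - {j}) = removeAll (vs ! j) vs" "nths vs (- ({..<length vs} - {j})) = [vs ! j]"
proof -
  have s1: "set (nths vs {j}) = {vs ! j}" using assms by (auto simp: set_nths)
  have s4: "set (nths vs (- ({..<length vs} - {j}))) = {vs ! j}" using assms by (auto simp: set_nths)
  have s2: "set (nths vs (- {j})) = set vs - {vs ! j}"
    using set_nths_compl[of vs "{j}"] assms by simp
  have s3: "set (nths vs ({..<length vs} - {j})) = set vs - {vs ! j}"
    unfolding s2[symmetric] by (auto simp: set_nths)
  show "nths vs {j} = [vs ! j]" "nths vs (- ({..<length vs} - {j})) = [vs ! j]"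
    using s1 s4 assms distinct_set_singleton by (metis distinct_nthsI)+
  show "nths vs (- {j}) = removeAll (vs ! j) vs"
    by (subst nths_eq_filter[OF assms(1)], unfold s2 removeAll_filter_not_eq, intro filter_cong) auto
  show "nths vs ({..<length vs} - {j}) = removeAll (vs ! j) vs"
    by (subst nths_eq_filter[OF assms(1)], unfold s3 removeAll_filter_not_eq, intro filter_cong) auto
qed

primrec position :: "'a list \<Rightarrow> 'a \<Rightarrow> nat" where
  "position [] x = 0"
| "position (y # ys) x = (if x = y then 0 else Suc (position ys x))"

lemma position_nth: "distinct vs \<Longrightarrow> j < length vs \<Longrightarrow> position vs (vs ! j) = j"
  by (induction vs arbitrary: j) (auto simp: nth_Cons split: nat.splits)

lemma removeAll_notin: "x \<notin> set vs \<Longrightarrow> removeAll x vs = vs"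
  by simp

text \<open>
  Removing \<open>x\<close> shifts \<open>z\<close> by one place exactly if \<open>x\<close> precedes \<open>z\<close>, and one of \<open>x\<close> and \<open>z\<close> precedes the other.
  This is the sign of a transposition, as it arises in two successive expansions.
\<close>

lemma position_swap_odd:
  "distinct vs \<Longrightarrow> x \<in> set vs \<Longrightarrow> z \<in> set vs \<Longrightarrow> x \<noteq> z \<Longrightarrow>
    odd (position vs x + position vs z + position (removeAll x vs) z + position (removeAll z vs) x)"
  by (induction vs) (auto simp: removeAll_notin)

lemma sum_Pow_singletons:
  fixes h :: "nat set \<Rightarrow> 'b::comm_monoid_add"
  assumes "\<And>I. I \<subseteq> {..<n} \<Longrightarrow> card I \<noteq> 1 \<Longrightarrow> h I = 0"
  shows "(\<Sum>I\<in>Pow {..<n}. h I) = (\<Sum>j<n. h {j})"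
proof -
  have "(\<Sum>j<n. h {j}) = sum h ((\<lambda>j. {j}) ` {..<n})"
    by (subst sum.reindex) (auto simp: inj_on_def)
  also have "\<dots> = (\<Sum>I\<in>Pow {..<n}. h I)"
    by (rule sum.mono_neutral_left) (auto intro!: assms simp: card_1_singleton_iff)
  finally show ?thesis by simp
qed

lemma sum_Pow_cosingletons:
  fixes h :: "nat set \<Rightarrow> 'b::comm_monoid_add"
  assumes "\<And>I. I \<subseteq> {..<n} \<Longrightarrow> card ({..<n} - I) \<noteq> 1 \<Longrightarrow> h I = 0"
  shows "(\<Sum>I\<in>Pow {..<n}. h I) = (\<Sum>j<n. h ({..<n} - {j}))"
proof -
  have "bij_betw (\<lambda>I. {..<n} - I) (Pow {..<n}) (Pow {..<n})"
    by (rule bij_betw_byWitness[where f' = "\<lambda>I. {..<n} - I"]) auto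
  then have "(\<Sum>I\<in>Pow {..<n}. h I) = (\<Sum>I\<in>Pow {..<n}. h ({..<n} - I))"
    by (rule sum.reindex_bij_betw[symmetric])
  also have "\<dots> = (\<Sum>j<n. h ({..<n} - {j}))"
    by (rule sum_Pow_singletons) (auto intro!: assms simp: double_diff)
  finally show ?thesis .
qed

lemma inversions_single: "inversions {j} = j"
proof -
  have "{(a, b). a \<in> {j} \<and> b \<notin> {j} \<and> b < a} = Pair j ` {..<j}" by auto
  then show ?thesis by (simp add: inversions_def card_image inj_on_def)
qed

lemma inversions_cosingle: "j < n \<Longrightarrow> inversions ({..<n} - {j}) = n - 1 - j"
proof -
  assume "j < n"
  then have "{(a, b). a \<in> {..<n} - {j} \<and> b \<notin> {..<n} - {j} \<and> b < a} = (\<lambda>a. (a, j)) ` {j<..<n}" by auto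
  then show ?thesis by (simp add: inversions_def card_image inj_on_def)
qed

text \<open>
  Laplace expansion: the shuffle that puts position \<open>j\<close> first has sign \<open>(-1) ^ j\<close>.
\<close>

lemma laplace_left:
  assumes \<alpha>: "supported 1 \<alpha>" and \<beta>: "supported q \<beta>" and vs: "distinct vs" and ws: "distinct ws"
  shows "sesq (1 + q) (\<alpha> \<and>\<and> \<beta>) vs ws = (\<Sum>x\<in>set vs. \<Sum>y\<in>set ws. (-1) ^ (position vs x + position ws y) *
    sesq 1 \<alpha> [x] [y] * sesq q \<beta> (removeAll x vs) (removeAll y ws))"
proof -
  let ?h = "\<lambda>I J. (-1) ^ (inversions I + inversions J) *
       sesq 1 \<alpha> (nths vs I) (nths ws J) * sesq q \<beta> (nths vs (- I)) (nths ws (- J))"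
  let ?g = "\<lambda>x y. (-1) ^ (position vs x + position ws y) *
    sesq 1 \<alpha> [x] [y] * sesq q \<beta> (removeAll x vs) (removeAll y ws)"
  have z: "?h I J = 0" if "I \<subseteq> {..<length vs}" "J \<subseteq> {..<length ws}" "card I \<noteq> 1 \<or> card J \<noteq> 1" for I J
  proof -
    have "\<alpha> (nths vs I) (nths ws J) = 0"
      using that \<alpha> length_nths_lessThan[of I vs] length_nths_lessThan[of J ws]
      unfolding supported_def by metis
    then show ?thesis by simp
  qed
  have "sesq (1 + q) (\<alpha> \<and>\<and> \<beta>) vs ws = (\<Sum>I\<in>Pow {..<length vs}. \<Sum>J\<in>Pow {..<length ws}. ?h I J)"
    by (rule sesq_wedge[OF \<alpha> \<beta>])
  also have "\<dots> = (\<Sum>j<length vs. \<Sum>J\<in>Pow {..<length ws}. ?h {j} J)"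
    by (intro sum_Pow_singletons sum.neutral ballI z) auto
  also have "\<dots> = (\<Sum>j<length vs. \<Sum>k<length ws. ?h {j} {k})"
    by (intro sum.cong refl sum_Pow_singletons z) auto
  also have "\<dots> = (\<Sum>j<length vs. \<Sum>k<length ws. ?g (vs ! j) (ws ! k))"
    by (intro sum.cong refl) (simp add: nths_single vs ws inversions_single position_nth)
  also have "\<dots> = (\<Sum>j<length vs. \<Sum>y\<in>set ws. ?g (vs ! j) y)"
    by (intro sum.cong refl sum.reindex_bij_betw[OF bij_betw_nth] ws)
  also have "\<dots> = (\<Sum>x\<in>set vs. \<Sum>y\<in>set ws. ?g x y)"
    by (intro sum.reindex_bij_betw[OF bij_betw_nth] vs refl)
  finally show ?thesis .
qed

text \<open>
  The shuffle that puts position \<open>j\<close> last has sign \<open>(-1) ^ (n - 1 - j)\<close>. The constant part of the exponent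
  occurs once for each group of arguments and cancels because the two lists have the same length.
\<close>

lemma laplace_right:
  assumes \<alpha>: "supported p \<alpha>" and \<beta>: "supported 1 \<beta>" and vs: "distinct vs" and ws: "distinct ws"
    and len: "length vs = length ws"
  shows "sesq (p + 1) (\<alpha> \<and>\<and> \<beta>) vs ws = (\<Sum>x\<in>set vs. \<Sum>y\<in>set ws. (-1) ^ (position vs x + position ws y) *
    sesq p \<alpha> (removeAll x vs) (removeAll y ws) * sesq 1 \<beta> [x] [y])"
proof -
  let ?n = "length ws"
  let ?h = "\<lambda>I J. (-1) ^ (inversions I + inversions J) *
       sesq p \<alpha> (nths vs I) (nths ws J) * sesq 1 \<beta> (nths vs (- I)) (nths ws (- J))"
  let ?g = "\<lambda>x y. (-1) ^ (position vs x + position ws y) *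
    sesq p \<alpha> (removeAll x vs) (removeAll y ws) * sesq 1 \<beta> [x] [y]"
  have z: "?h I J = 0" if "card ({..<?n} - I) \<noteq> 1 \<or> card ({..<?n} - J) \<noteq> 1" for I J
  proof -
    have "\<beta> (nths vs (- I)) (nths ws (- J)) = 0"
      using that \<beta> length_nths_compl[of vs I] length_nths_compl[of ws J] len
      unfolding supported_def by metis
    then show ?thesis by simp
  qed
  have sgn: "(-1) ^ (inversions ({..<?n} - {j}) + inversions ({..<?n} - {k})) = (-1 :: complex) ^ (j + k)"
    if "j < ?n" "k < ?n" for j k
  proof -
    have "even (?n - 1 - j + (?n - 1 - k)) \<longleftrightarrow> even (j + k)" using that by presburger
    then show ?thesis by (simp add: inversions_cosingle that minus_one_power_iff del: even_add)
  qed
  have "sesq (p + 1) (\<alpha> \<and>\<and> \<beta>) vs ws = (\<Sum>I\<in>Pow {..<?n}. \<Sum>J\<in>Pow {..<?n}. ?h I J)"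
    unfolding sesq_wedge[OF \<alpha> \<beta>] len ..
  also have "\<dots> = (\<Sum>j<?n. \<Sum>J\<in>Pow {..<?n}. ?h ({..<?n} - {j}) J)"
    by (intro sum_Pow_cosingletons sum.neutral ballI z) auto
  also have "\<dots> = (\<Sum>j<?n. \<Sum>k<?n. ?h ({..<?n} - {j}) ({..<?n} - {k}))"
    by (intro sum.cong refl sum_Pow_cosingletons z) auto
  also have "\<dots> = (\<Sum>j<?n. \<Sum>k<?n. ?g (vs ! j) (ws ! k))"
  proof (intro sum.cong refl)
    fix j k assume "j \<in> {..<?n}" "k \<in> {..<?n}"
    then have jk: "j < ?n" "k < ?n" by auto
    show "?h ({..<?n} - {j}) ({..<?n} - {k}) = ?g (vs ! j) (ws ! k)"
      unfolding sgn[OF jk] nths_single(3,4)[OF ws jk(2)]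
      using nths_single(3,4)[OF vs, of j] jk by (simp add: len position_nth vs ws)
  qed
  also have "\<dots> = (\<Sum>j<length vs. \<Sum>y\<in>set ws. ?g (vs ! j) y)"
    unfolding len by (intro sum.cong refl sum.reindex_bij_betw[OF bij_betw_nth] ws)
  also have "\<dots> = (\<Sum>x\<in>set vs. \<Sum>y\<in>set ws. ?g x y)"
    by (intro sum.reindex_bij_betw[OF bij_betw_nth] vs refl)
  finally show ?thesis .
qed

lemma removeAll_commute: "removeAll x (removeAll y vs) = removeAll y (removeAll x vs)"
  by (induction vs) auto

lemma length_removeAll_distinct: "distinct vs \<Longrightarrow> x \<in> set vs \<Longrightarrow> length (removeAll x vs) = length vs - 1"
  by (metis distinct_remove1_removeAll length_remove1)

text \<open>
  Expand along \<open>\<alpha>\<close>, evaluated at \<open>(x, y)\<close>, and along \<open>\<beta>\<close>, evaluated at \<open>(z, w)\<close>. As \<open>\<Omega>\<close> is diagonal, only the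
  terms with \<open>{x, z} = {y, w}\<close> remain: those with \<open>y = x\<close> and \<open>w = z\<close> have sign \<open>1\<close>, and those with
  \<open>y = z\<close> and \<open>w = x\<close> have sign \<open>-1\<close> by \<open>position_swap_odd\<close>.
\<close>

lemma sesq_sandwich_diagonal:
  assumes \<alpha>: "supported 1 \<alpha>" and \<beta>: "supported 1 \<beta>" and \<Omega>: "diagonal_on (set vs) m \<Omega> c"
    and vs: "distinct vs" "length vs = m + 2"
  shows "sesq (m + 2) (\<alpha> \<and>\<and> \<Omega> \<and>\<and> \<beta>) vs vs = (\<Sum>x\<in>set vs. \<Sum>z\<in>set vs - {x}. c (set vs - {x, z}) *
    (sesq 1 \<alpha> [x] [x] * sesq 1 \<beta> [z] [z] - sesq 1 \<alpha> [x] [z] * sesq 1 \<beta> [z] [x]))"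
proof -
  note s\<Omega> = diagonal_on_supported[OF \<Omega>]
  let ?r = "\<lambda>x. removeAll x vs"
  let ?t = "\<lambda>x z y w. (-1) ^ (position vs x + position vs y + (position (?r x) z + position (?r y) w)) * sesq 1 \<alpha> [x] [y] * sesq 1 \<beta> [z] [w] *
          sesq m \<Omega> (removeAll z (?r x)) (removeAll w (?r y))"
  let ?C = "\<lambda>x z. c (set vs - {x, z}) *
    (sesq 1 \<alpha> [x] [x] * sesq 1 \<beta> [z] [z] - sesq 1 \<alpha> [x] [z] * sesq 1 \<beta> [z] [x])"
  have "sesq (m + 2) (\<alpha> \<and>\<and> \<Omega> \<and>\<and> \<beta>) vs vs = sesq (1 + (m + 1)) (\<alpha> \<and>\<and> \<Omega> \<and>\<and> \<beta>) vs vs" by simp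
  also have "\<dots> = (\<Sum>x\<in>set vs. \<Sum>y\<in>set vs. (-1) ^ (position vs x + position vs y) *
      sesq 1 \<alpha> [x] [y] * sesq (m + 1) (\<Omega> \<and>\<and> \<beta>) (?r x) (?r y))"
    by (rule laplace_left[OF \<alpha> supported_wedge[OF s\<Omega> \<beta>] vs(1) vs(1)])
  also have "\<dots> = (\<Sum>x\<in>set vs. \<Sum>y\<in>set vs. \<Sum>z\<in>set vs - {x}. \<Sum>w\<in>set vs - {y}. ?t x z y w)"
  proof (intro sum.cong refl)
    fix x y assume xy: "x \<in> set vs" "y \<in> set vs"
    have l: "length (?r x) = length (?r y)" using vs xy by (simp add: length_removeAll_distinct)
    show "(-1) ^ (position vs x + position vs y) * sesq 1 \<alpha> [x] [y] * sesq (m + 1) (\<Omega> \<and>\<and> \<beta>) (?r x) (?r y) =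
        (\<Sum>z\<in>set vs - {x}. \<Sum>w\<in>set vs - {y}. ?t x z y w)"
      unfolding laplace_right[OF s\<Omega> \<beta> distinct_removeAll[OF vs(1)] distinct_removeAll[OF vs(1)] l]
        set_removeAll sum_distrib_left
      by (intro sum.cong refl) (simp add: power_add)
  qed
  also have "\<dots> = (\<Sum>x\<in>set vs. \<Sum>z\<in>set vs - {x}. \<Sum>y\<in>set vs. \<Sum>w\<in>set vs - {y}. ?t x z y w)"
    by (intro sum.cong refl sum.swap)
  also have "\<dots> = (\<Sum>x\<in>set vs. \<Sum>z\<in>set vs - {x}. ?C x z)"
  proof (intro sum.cong refl)
    fix x z assume x: "x \<in> set vs" and z: "z \<in> set vs - {x}"
    have zero: "?t x z y w = 0" if "y \<in> set vs" "w \<in> set vs - {y}" "{x, z} \<noteq> {y, w}" for y w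
    proof -
      have "set vs - {x} - {z} \<noteq> set vs - {y} - {w}"
        using that x z by (metis DiffD1 Diff_insert2 double_diff empty_subsetI insert_subset order_refl)
      then have "\<Omega> (removeAll z (?r x)) (removeAll w (?r y)) = 0"
        using vs by (intro diagonal_on_off[OF \<Omega>]) (auto simp: distinct_removeAll)
      then show ?thesis by simp
    qed
    have val: "sesq m \<Omega> (removeAll z (?r x)) (removeAll z (?r x)) = c (set vs - {x, z})"
    proof -
      have "sesq m \<Omega> (removeAll z (?r x)) (removeAll z (?r x)) = c (set (removeAll z (?r x)))"
        using vs x z by (intro diagonal_on_diag[OF \<Omega>]) (auto simp: length_removeAll_distinct distinct_removeAll)
      also have "set (removeAll z (?r x)) = set vs - {x, z}" by auto
      finally show ?thesis .
    qed
    have "(\<Sum>w\<in>set vs - {y}. ?t x z y w) = 0" if "y \<in> set vs - {x, z}" for y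
      using that by (intro sum.neutral ballI zero) auto
    then have "(\<Sum>y\<in>set vs. \<Sum>w\<in>set vs - {y}. ?t x z y w) = (\<Sum>y\<in>{x, z}. \<Sum>w\<in>set vs - {y}. ?t x z y w)"
      using x z by (intro sum.mono_neutral_right ballI) auto
    also have "\<dots> = (\<Sum>w\<in>set vs - {x}. ?t x z x w) + (\<Sum>w\<in>set vs - {z}. ?t x z z w)"
      using z by auto
    also have "(\<Sum>w\<in>set vs - {x}. ?t x z x w) = (\<Sum>w\<in>{z}. ?t x z x w)"
      using x z by (intro sum.mono_neutral_right ballI zero) auto
    also have "(\<Sum>w\<in>set vs - {z}. ?t x z z w) = (\<Sum>w\<in>{x}. ?t x z z w)"
      using x z by (intro sum.mono_neutral_right ballI zero) auto
    also have "(\<Sum>w\<in>{z}. ?t x z x w) = sesq 1 \<alpha> [x] [x] * sesq 1 \<beta> [z] [z] * c (set vs - {x, z})"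
      by (simp add: val)
    also have "(\<Sum>w\<in>{x}. ?t x z z w) = - (sesq 1 \<alpha> [x] [z] * sesq 1 \<beta> [z] [x] * c (set vs - {x, z}))"
    proof -
      have "odd (position vs x + position vs z + (position (?r x) z + position (?r z) x))"
        using position_swap_odd[OF vs(1) x, of z] z by (auto simp: add.assoc)
      then have "(-1 :: complex) ^ (position vs x + position vs z + (position (?r x) z + position (?r z) x)) = -1"
        by (rule neg_one_odd_power)
      then show ?thesis using val by (simp add: removeAll_commute[of x z])
    qed
    finally show "(\<Sum>y\<in>set vs. \<Sum>w\<in>set vs - {y}. ?t x z y w) = ?C x z"
      by (simp add: algebra_simps)
  qed
  finally show ?thesis .
qed

lemma sesq_square_pair:
  assumes \<omega>: "supported 1 \<omega>" and uv: "u \<noteq> v"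
  shows "sesq 2 (wpow \<omega> 2) [u, v] [u, v] =
    2 * (sesq 1 \<omega> [u] [u] * sesq 1 \<omega> [v] [v] - sesq 1 \<omega> [u] [v] * sesq 1 \<omega> [v] [u])"
proof -
  have su: "supported 0 unit_form" by (auto simp: supported_def unit_form_def)
  have 1: "sesq 1 (\<omega> \<and>\<and> unit_form) [a] [b] = sesq 1 \<omega> [a] [b]" for a b
    using laplace_left[OF \<omega> su, of "[a]" "[b]"] by (simp add: sesq_def unit_form_def)
  have "sesq (1 + 1) (\<omega> \<and>\<and> (\<omega> \<and>\<and> unit_form)) [u, v] [u, v] =
    2 * (sesq 1 \<omega> [u] [u] * sesq 1 \<omega> [v] [v] - sesq 1 \<omega> [u] [v] * sesq 1 \<omega> [v] [u])"
    using laplace_left[OF \<omega>, of 1 "\<omega> \<and>\<and> unit_form" "[u, v]" "[u, v]"] supported_wedge[OF \<omega> su] uv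
    by (simp add: 1[simplified])
  then show ?thesis by (simp add: numeral_2_eq_2)
qed

section \<open>Lorentzian bilinear forms and Hermitian coordinates\<close>

lemma additive_homogeneous_sum:
  fixes f :: "'b::ab_group_add \<Rightarrow> real"
  assumes "vector_space s" "module.subspace s W"
    and add: "\<And>x y. x \<in> W \<Longrightarrow> y \<in> W \<Longrightarrow> f (x + y) = f x + f y"
    and hom: "\<And>r x. x \<in> W \<Longrightarrow> f (s r x) = r * f x"
    and x: "\<And>i. i \<in> A \<Longrightarrow> x i \<in> W"
  shows "f (\<Sum>i\<in>A. s (c i) (x i)) = (\<Sum>i\<in>A. c i * f (x i))"
proof -
  interpret vector_space s by fact
  have "f 0 = 0" using hom[of 0 0] subspace_0[OF assms(2)] by simp
  then show ?thesis using x
  proof (induction A rule: infinite_finite_induct)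
    case (insert i A)
    have "(\<Sum>i\<in>A. s (c i) (x i)) \<in> W"
      using insert.prems by (intro subspace_sum subspace_scale assms(2)) auto
    then show ?case
      using insert by (simp add: add hom subspace_scale[OF assms(2)])
  qed auto
qed

lemma basis_from_coordinates:
  fixes s :: "real \<Rightarrow> 'b::ab_group_add \<Rightarrow> 'b" and \<phi> :: "'p \<Rightarrow> 'b \<Rightarrow> real"
  assumes vs: "vector_space s" and W: "module.subspace s W" and P: "finite P"
    and E: "\<And>p. p \<in> P \<Longrightarrow> E p \<in> W"
    and add: "\<And>p x y. x \<in> W \<Longrightarrow> y \<in> W \<Longrightarrow> \<phi> p (x + y) = \<phi> p x + \<phi> p y"
    and hom: "\<And>p r x. x \<in> W \<Longrightarrow> \<phi> p (s r x) = r * \<phi> p x"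
    and dual: "\<And>p q. p \<in> P \<Longrightarrow> q \<in> P \<Longrightarrow> \<phi> p (E q) = (if p = q then 1 else 0)"
    and sep: "\<And>x. x \<in> W \<Longrightarrow> (\<And>p. p \<in> P \<Longrightarrow> \<phi> p x = 0) \<Longrightarrow> x = 0"
  shows "card (E ` P) = card P" "\<not> module.dependent s (E ` P)" "module.span s (E ` P) = W"
proof -
  interpret vector_space s by fact
  have inj: "inj_on E P"
    using dual by (intro inj_onI) (metis zero_neq_one)
  then show "card (E ` P) = card P" by (rule card_image)
  have coord: "\<phi> q (\<Sum>p\<in>P. s (c p) (E p)) = c q" if "q \<in> P" for c q
  proof -
    have "\<phi> q (\<Sum>p\<in>P. s (c p) (E p)) = (\<Sum>p\<in>P. c p * \<phi> q (E p))"
      by (rule additive_homogeneous_sum[OF vs W add hom E])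
    also have "\<dots> = (\<Sum>p\<in>P. if p = q then c p else 0)"
      using that by (intro sum.cong refl) (auto simp: dual)
    finally show ?thesis using that P by simp
  qed
  have \<phi>0: "\<phi> p 0 = 0" for p using hom[of 0 p 0] subspace_0[OF W] by simp
  show "\<not> dependent (E ` P)"
  proof
    assume "dependent (E ` P)"
    then obtain u q where u: "q \<in> P" "u (E q) \<noteq> 0" "(\<Sum>v\<in>E ` P. s (u v) v) = 0"
      using P by (auto simp: dependent_finite)
    then have "(\<Sum>p\<in>P. s (u (E p)) (E p)) = 0" by (simp add: sum.reindex[OF inj])
    then show False using coord[OF u(1), of "\<lambda>p. u (E p)"] u(2) \<phi>0 by simp
  qed
  show "span (E ` P) = W"
  proof
    show "span (E ` P) \<subseteq> W" using E W by (intro span_minimal) auto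
    show "W \<subseteq> span (E ` P)"
    proof
      fix x assume x: "x \<in> W"
      define y where "y = (\<Sum>p\<in>P. s (\<phi> p x) (E p))"
      have y: "y \<in> W" unfolding y_def using E by (intro subspace_sum subspace_scale W) auto
      have "x + s (-1) y = 0"
      proof (rule sep)
        show "x + s (-1) y \<in> W" using x y W by (intro subspace_add subspace_scale) auto
        show "\<phi> p (x + s (-1) y) = 0" if "p \<in> P" for p
          using coord[OF that, of "\<lambda>p. \<phi> p x"] x y
          by (simp add: add hom subspace_scale[OF W] y_def[symmetric] del: scale_minus_left)
      qed
      then have "x = y" by simp
      moreover have "y \<in> span (E ` P)" unfolding y_def by (intro span_sum span_scale span_base imageI)
      ultimately show "x \<in> span (E ` P)" by simp
    qed
  qed
qed

text \<open>
  A vector \<open>y\<close> orthogonal to \<open>x0\<close> spans together with \<open>x0\<close> a plane that meets the kernel of \<open>\<phi>\<close>, where \<open>b\<close>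
  is negative; hence \<open>b\<close> is negative at \<open>y\<close>, and so negative definite on the orthogonal complement of
  \<open>x0\<close>. The Gram-Schmidt process therefore extends \<open>x0\<close> to an orthogonal basis.
\<close>

lemma lorentzian_orthogonal_basis:
  fixes s :: "real \<Rightarrow> 'b::ab_group_add \<Rightarrow> 'b" and b :: "'b \<Rightarrow> 'b \<Rightarrow> real" and \<phi> :: "'b \<Rightarrow> real"
  assumes vs: "vector_space s"
    and T: "finite T" "\<not> module.dependent s T" "module.span s T = W"
    and sym: "\<And>x y. x \<in> W \<Longrightarrow> y \<in> W \<Longrightarrow> b x y = b y x"
    and badd: "\<And>x y z. x \<in> W \<Longrightarrow> y \<in> W \<Longrightarrow> z \<in> W \<Longrightarrow> b (x + y) z = b x z + b y z"
    and bhom: "\<And>r x z. x \<in> W \<Longrightarrow> z \<in> W \<Longrightarrow> b (s r x) z = r * b x z"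
    and x0: "x0 \<in> W" "b x0 x0 > 0"
    and fadd: "\<And>x y. x \<in> W \<Longrightarrow> y \<in> W \<Longrightarrow> \<phi> (x + y) = \<phi> x + \<phi> y"
    and fhom: "\<And>r x. x \<in> W \<Longrightarrow> \<phi> (s r x) = r * \<phi> x"
    and neg: "\<And>x. x \<in> W \<Longrightarrow> x \<noteq> 0 \<Longrightarrow> \<phi> x = 0 \<Longrightarrow> b x x < 0"
  obtains N where "finite N" "x0 \<notin> N" "card N = card T - 1" "\<not> module.dependent s (insert x0 N)"
    "module.span s (insert x0 N) = W" "\<And>x y. x \<in> insert x0 N \<Longrightarrow> y \<in> insert x0 N \<Longrightarrow> x \<noteq> y \<Longrightarrow> b x y = 0"
    "\<And>x. x \<in> N \<Longrightarrow> b x x < 0"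
proof -
  interpret vector_space s by fact
  have W: "subspace W" using T(3) subspace_span by blast
  note Wadd = subspace_add[OF W] and Wsc = subspace_scale[OF W]
  have badd': "b z (x + y) = b z x + b z y" if "x \<in> W" "y \<in> W" "z \<in> W" for x y z
    using that by (simp add: sym[of z] badd Wadd)
  have bhom': "b z (s r x) = r * b z x" if "x \<in> W" "z \<in> W" for r x z
    using that by (simp add: sym[of z] bhom Wsc)
  have b0: "b 0 z = 0" if "z \<in> W" for z using bhom[of 0 z 0] that subspace_0[OF W] by simp
  have perp: "b y y < 0" if y: "y \<in> W" "y \<noteq> 0" "b x0 y = 0" for y
  proof (cases "\<phi> y = 0")
    case False
    \<comment> \<open>The intersection of the plane spanned by \<open>x0\<close> and \<open>y\<close> with the kernel of \<open>\<phi>\<close>.\<close>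
    define z where "z = s (\<phi> y) x0 + s (- \<phi> x0) y"
    have zW: "z \<in> W" unfolding z_def by (intro Wadd Wsc x0 y)
    have "\<phi> z = 0" unfolding z_def by (simp add: fadd fhom Wsc x0 y del: scale_minus_left)
    moreover have "z \<noteq> 0"
    proof
      assume "z = 0"
      then have "b z x0 = 0" using b0 x0 by simp
      moreover have "b z x0 = \<phi> y * b x0 x0"
        unfolding z_def using y x0 by (simp add: badd bhom Wsc sym[of y x0] del: scale_minus_left)
      ultimately show False using False x0 by simp
    qed
    ultimately have "b z z < 0" using neg zW by blast
    moreover have "b z z = (\<phi> y)\<^sup>2 * b x0 x0 + (\<phi> x0)\<^sup>2 * b y y"
      unfolding z_def using y x0
      by (simp add: badd badd' bhom bhom' Wsc Wadd sym[of y x0] power2_eq_square del: scale_minus_left)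
    ultimately have "(\<phi> x0)\<^sup>2 * b y y < 0" using x0 by (smt (verit) mult_nonneg_nonneg zero_le_power2)
    then show ?thesis by (simp add: mult_less_0_iff)
  qed (use neg that in blast)
  define good where "good N \<longleftrightarrow> finite N \<and> N \<subseteq> W \<and> x0 \<notin> N \<and>
      (\<forall>x\<in>insert x0 N. \<forall>y\<in>insert x0 N. x \<noteq> y \<longrightarrow> b x y = 0) \<and> (\<forall>x\<in>N. b x x < 0)" for N
  have "\<exists>N. good N \<and> card N = k" if "k < card T" for k
    using that
  proof (induction k)
    case 0
    then show ?case by (intro exI[of _ "{}"]) (simp add: good_def)
  next
    case (Suc k)
    then obtain N where N: "good N" "card N = k" by auto
    let ?M = "insert x0 N"
    have M: "finite ?M" "?M \<subseteq> W" "card ?M = Suc k" using N x0 by (auto simp: good_def)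
    have orth: "b x y = 0" if "x \<in> ?M" "y \<in> ?M" "x \<noteq> y" for x y
      using N that unfolding good_def by blast
    have nz: "b e e \<noteq> 0" if "e \<in> ?M" for e using that N x0 unfolding good_def by fastforce
    have "\<not> T \<subseteq> span ?M"
      using independent_span_bound[OF M(1) T(2)] M(3) Suc.prems by auto
    then obtain y where y: "y \<in> W" "y \<notin> span ?M" using T(3) span_base by blast
    define z where "z = (\<Sum>e\<in>?M. s (- b y e / b e e) e)"
    have zW: "z \<in> W" unfolding z_def using M W by (intro subspace_sum subspace_scale) auto
    have zM: "z \<in> span ?M" unfolding z_def by (intro span_sum span_scale span_base)
    have yzW: "y + z \<in> W" by (intro Wadd y zW)
    have nin: "y + z \<notin> span ?M" using y zM span_add_eq2[of z ?M y] by blast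
    have ortho: "b (y + z) e = 0" if e: "e \<in> ?M" for e
    proof -
      have eW: "e \<in> W" using e M by auto
      have "b z e = (\<Sum>e'\<in>?M. - b y e' / b e' e' * b e' e)"
        unfolding z_def using M eW
        by (intro additive_homogeneous_sum[OF vs W, of "\<lambda>x. b x e"]) (auto simp: badd bhom)
      also have "\<dots> = (\<Sum>e'\<in>?M. if e' = e then - b y e else 0)"
        using orth nz e by (intro sum.cong refl) auto
      also have "\<dots> = - b y e" using e M(1) by simp
      finally show ?thesis using badd[OF y(1) zW eW] by simp
    qed
    have "y + z \<noteq> 0" using nin span_zero by metis
    then have "b (y + z) (y + z) < 0"
      using perp[OF yzW] ortho[of x0] sym[OF x0(1) yzW] by simp
    moreover have ynM: "y + z \<notin> ?M" using nin span_base by blast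
    moreover have "b e (y + z) = 0" if "e \<in> ?M" for e
      using ortho[OF that] sym[OF yzW, of e] that M(2) by auto
    ultimately have "good (insert (y + z) N)"
      using N(1) yzW ortho unfolding good_def by blast
    moreover have "card (insert (y + z) N) = Suc k"
      using N ynM unfolding good_def by simp
    ultimately show ?case by blast
  qed
  moreover have "card T > 0"
  proof -
    have "x0 \<noteq> 0" using b0[OF x0(1)] x0 by auto
    then have "T \<noteq> {}" using x0 T(3) by auto
    then show ?thesis using T(1) by (simp add: card_gt_0_iff)
  qed
  ultimately obtain N where N: "good N" "card N = card T - 1" by (metis diff_less zero_less_one)
  let ?M = "insert x0 N"
  have M: "finite ?M" "?M \<subseteq> W" "card ?M = card T" using N x0 \<open>card T > 0\<close> by (auto simp: good_def)
  have orth: "b x y = 0" if "x \<in> ?M" "y \<in> ?M" "x \<noteq> y" for x y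
    using N that unfolding good_def by blast
  have nz: "b e e \<noteq> 0" if "e \<in> ?M" for e using that N x0 unfolding good_def by fastforce
  have indep: "\<not> dependent ?M"
  proof
    assume "dependent ?M"
    then obtain u e where u: "e \<in> ?M" "u e \<noteq> 0" "(\<Sum>v\<in>?M. s (u v) v) = 0"
      using M(1) by (auto simp only: dependent_finite)
    have eW: "e \<in> W" using u M by auto
    have "b (\<Sum>v\<in>?M. s (u v) v) e = (\<Sum>v\<in>?M. u v * b v e)"
      using M eW by (intro additive_homogeneous_sum[OF vs W, of "\<lambda>x. b x e"]) (auto simp: badd bhom)
    also have "\<dots> = (\<Sum>v\<in>?M. if v = e then u e * b e e else 0)"
      using orth u by (intro sum.cong refl) auto
    also have "\<dots> = u e * b e e" using u M(1) by simp
    finally show False using u nz b0[OF eW] by simp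
  qed
  have "span ?M = W"
  proof
    show "span ?M \<subseteq> W" using M W by (intro span_minimal) auto
    show "W \<subseteq> span ?M"
    proof
      fix y assume y: "y \<in> W"
      show "y \<in> span ?M"
      proof (rule ccontr)
        assume n: "y \<notin> span ?M"
        then have "\<not> dependent (insert y ?M)" using indep independent_insertI by blast
        from independent_span_bound[OF T(1) this] y M T(3)
        have "card (insert y ?M) \<le> card T" by auto
        moreover have "y \<notin> ?M" using n span_base by blast
        ultimately show False using M by simp
      qed
    qed
  qed
  with N indep orth show ?thesis by (intro that[of N]) (simp_all add: good_def)
qed

lemma vector_space_rscale: "vector_space (rscale :: real \<Rightarrow> 'v form \<Rightarrow> 'v form)"
  by unfold_locales (auto simp: rscale_def cscale_def algebra_simps fun_eq_iff)

lemma subspace_real_forms: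
  assumes "vector_space sc" shows "module.subspace rscale (real_forms sc p)"
proof -
  interpret r: vector_space rscale by (rule vector_space_rscale)
  show ?thesis
    using assms by (auto simp: r.subspace_def real_forms_add real_forms_zero real_forms_rscale)
qed

text \<open>
  The form of type \<open>(1, 1)\<close> that corresponds to \<open>h\<close> under \<open>sesq\<close>.
\<close>

definition sesquilinear_form :: "('v \<Rightarrow> 'v \<Rightarrow> complex) \<Rightarrow> 'v form" where
  "sesquilinear_form h = (\<lambda>vs ws. if length vs = 1 \<and> length ws = 1 then \<i> * h (hd vs) (hd ws) else 0)"

lemma sesq_sesquilinear_form [simp]: "sesq 1 (sesquilinear_form h) [v] [w] = h v w"
  "sesq (Suc 0) (sesquilinear_form h) [v] [w] = h v w"
  by (simp_all add: sesq_def sesquilinear_form_def)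

lemma sesquilinear_form_real:
  assumes "vector_space sc" "\<And>w. complex_linear sc (\<lambda>v. h v w)" "\<And>v w. h w v = cnj (h v w)"
  shows "sesquilinear_form h \<in> real_forms sc 1"
  unfolding real_forms_iff[OF assms(1)]
proof (intro conjI allI)
  fix vs ws :: "'a list"
  show "alternating sc 1 (\<lambda>vs. sesquilinear_form h vs ws)"
    unfolding alternating_def
  proof (intro conjI allI impI)
    fix vs :: "'a list" and i assume i: "i < length vs"
    show "complex_linear sc (\<lambda>x. sesquilinear_form h (vs[i := x]) ws)"
    proof (cases "length vs = 1 \<and> length ws = 1")
      case True
      then obtain a where "vs = [a]" by (auto simp: length_Suc_conv)
      then show ?thesis using True i assms(2) by (simp add: sesquilinear_form_def complex_linear_cmult)
    next
      case False
      then have "(\<lambda>x. sesquilinear_form h (vs[i := x]) ws) = (\<lambda>x. 0)" by (auto simp: sesquilinear_form_def)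
      then show ?thesis by simp
    qed
  next
    fix vs :: "'a list" assume "\<not> distinct vs"
    then have "length vs \<noteq> 1" by (auto simp: length_Suc_conv)
    then show "sesquilinear_form h vs ws = 0" by (simp add: sesquilinear_form_def)
  qed (simp add: sesquilinear_form_def)
  show "sesq 1 (sesquilinear_form h) ws vs = cnj (sesq 1 (sesquilinear_form h) vs ws)"
    using assms(3)[of "hd ws" "hd vs"] by (auto simp: sesq_def sesquilinear_form_def)
qed

lemma form11_eq_zero:
  assumes "supported 1 \<alpha>" "\<And>v w. sesq 1 \<alpha> [v] [w] = 0"
  shows "\<alpha> = 0"
proof (intro ext)
  fix vs ws
  show "\<alpha> vs ws = 0 vs ws"
  proof (rule ccontr)
    assume "\<alpha> vs ws \<noteq> 0 vs ws"
    then have n: "\<alpha> vs ws \<noteq> 0" by simp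
    then have "length vs = 1" "length ws = 1" using assms(1) unfolding supported_def by blast+
    then obtain v w where "vs = [v]" "ws = [w]" by (auto simp: length_Suc_conv)
    then show False using n assms(2)[of v w] by simp
  qed
qed

lemma real_form11_complex_linear:
  assumes "vector_space sc" "\<alpha> \<in> real_forms sc 1"
  shows "complex_linear sc (\<lambda>v. sesq 1 \<alpha> [v] [w])"
  unfolding sesq_def divide_inverse
  by (rule complex_linear_multc, rule alternating_complex_linear_head[OF real_forms_alternating[OF assms]])

context complex_basis begin

abbreviation coord :: "nat \<Rightarrow> 'v \<Rightarrow> complex" where
  "coord j v \<equiv> representation (set bs) v (bs ! j)"

lemma coord_complex_linear: "complex_linear scale (coord j)"
  using representation_add[OF indep_bs] representation_scale[OF indep_bs] span_bs
  by (simp add: complex_linear_def)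

lemma coord_basis: "j < d \<Longrightarrow> k < d \<Longrightarrow> coord j (bs ! k) = (if j = k then 1 else 0)"
  using representation_basis[OF indep_bs, of "bs ! k"] distinct_bs by (auto simp: nth_eq_iff_index_eq)

lemma complex_linear_eq_zero_on_basis:
  assumes "complex_linear scale f" "\<And>b. b \<in> set bs \<Longrightarrow> f b = 0" shows "f v = 0"
proof -
  have "v = (\<Sum>b\<in>set bs. scale (representation (set bs) v b) b)"
    using sum_representation_eq[OF indep_bs, of v "set bs"] span_bs by simp
  then have "f v = f (\<Sum>b\<in>set bs. scale (representation (set bs) v b) b)" by (rule arg_cong)
  also have "\<dots> = (\<Sum>b\<in>set bs. representation (set bs) v b * f b)"
    by (rule complex_linear_apply_sum[OF assms(1)])
  finally have "f v = (\<Sum>b\<in>set bs. representation (set bs) v b * f b)" .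
  then show ?thesis using assms(2) by simp
qed

lemma real_form11_eq_zero:
  assumes \<alpha>: "\<alpha> \<in> real_forms scale 1" and z: "\<And>a b. a \<in> set bs \<Longrightarrow> b \<in> set bs \<Longrightarrow> sesq 1 \<alpha> [a] [b] = 0"
  shows "\<alpha> = 0"
proof (rule form11_eq_zero[OF real_forms_supported[OF \<alpha>]])
  note lin = real_form11_complex_linear[OF vector_space_axioms \<alpha>]
  have 1: "sesq 1 \<alpha> [v] [b] = 0" if "b \<in> set bs" for v b
    using complex_linear_eq_zero_on_basis[OF lin z[OF _ that]] .
  have "sesq 1 \<alpha> [b] [v] = 0" if "b \<in> set bs" for v b
    using real_forms_hermitian[OF \<alpha>, of "[b]" "[v]"] 1[OF that, of v] by simp
  then show "sesq 1 \<alpha> [v] [w] = 0" for v w using complex_linear_eq_zero_on_basis[OF lin] by blast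
qed

text \<open>
  A basis of the real space of Hermitian matrices, indexed by all pairs \<open>(j, k)\<close>: the diagonal units, the
  symmetric units above the diagonal and \<open>\<i>\<close> times the antisymmetric ones below. The dual coordinates
  are real parts on and above the diagonal and imaginary parts below it.
\<close>

definition hermitian_unit :: "nat \<times> nat \<Rightarrow> 'v form" where
  "hermitian_unit = (\<lambda>(j, k). sesquilinear_form (\<lambda>v w.
     if j = k then coord j v * cnj (coord j w)
     else if j < k then coord j v * cnj (coord k w) + coord k v * cnj (coord j w)
     else \<i> * (coord j v * cnj (coord k w) - coord k v * cnj (coord j w))))"

definition hermitian_coord :: "nat \<times> nat \<Rightarrow> 'v form \<Rightarrow> real" where
  "hermitian_coord = (\<lambda>(j, k) \<alpha>.
     if j \<le> k then Re (sesq 1 \<alpha> [bs ! j] [bs ! k]) else Im (sesq 1 \<alpha> [bs ! j] [bs ! k]))"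

lemma hermitian_unit_real: "hermitian_unit p \<in> real_forms scale 1"
proof (cases p)
  case (Pair j k)
  note c = coord_complex_linear[THEN complex_linear_multc]
  have cd: "complex_linear scale (\<lambda>v. f v - g v)" if "complex_linear scale f" "complex_linear scale g" for f g
    using complex_linear_add[OF that(1) complex_linear_cmult[OF that(2), of "-1"]] by simp
  show ?thesis
    unfolding hermitian_unit_def Pair prod.case
    by (rule sesquilinear_form_real[OF vector_space_axioms]; cases j k rule: linorder_cases)
       (auto intro!: c complex_linear_add complex_linear_cmult cd simp: algebra_simps)
qed

lemma real_forms11_basis:
  obtains T where "finite T" "\<not> module.dependent rscale T" "module.span rscale T = real_forms scale 1"
    "card T = d\<^sup>2"
proof -
  let ?P = "{..<d} \<times> {..<d}"
  note B = basis_from_coordinates[OF vector_space_rscale subspace_real_forms[OF vector_space_axioms],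
      of ?P hermitian_unit 1 hermitian_coord]
  have fin: "finite ?P" by simp
  have dual:
    "\<And>p x y. hermitian_coord p (x + y) = hermitian_coord p x + hermitian_coord p y"
    "\<And>p r x. hermitian_coord p (rscale r x) = r * hermitian_coord p x"
    "\<And>p q. p \<in> ?P \<Longrightarrow> q \<in> ?P \<Longrightarrow> hermitian_coord p (hermitian_unit q) = (if p = q then 1 else 0)"
    by (auto simp: hermitian_coord_def hermitian_unit_def sesq_add sesq_rscale coord_basis split: if_splits)
  have sep: "x = 0" if x: "x \<in> real_forms scale 1" and z: "\<And>p. p \<in> ?P \<Longrightarrow> hermitian_coord p x = 0" for x
  proof (rule real_form11_eq_zero[OF x])
    fix a b assume "a \<in> set bs" "b \<in> set bs"
    then obtain j k where jk: "j < d" "k < d" "a = bs ! j" "b = bs ! k" by (auto simp: in_set_conv_nth)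
    have "sesq 1 x [b] [a] = cnj (sesq 1 x [a] [b])" by (rule real_forms_hermitian[OF x])
    then have "Re (sesq 1 x [b] [a]) = Re (sesq 1 x [a] [b])" "Im (sesq 1 x [b] [a]) = - Im (sesq 1 x [a] [b])"
      by simp_all
    then show "sesq 1 x [a] [b] = 0"
      using z[of "(j, k)"] z[of "(k, j)"] jk
      by (cases j k rule: linorder_cases) (auto simp: hermitian_coord_def complex_eq_iff)
  qed
  have b: "card (hermitian_unit ` ?P) = card ?P" "\<not> module.dependent rscale (hermitian_unit ` ?P)"
    "module.span rscale (hermitian_unit ` ?P) = real_forms scale 1"
    by (rule B[OF fin hermitian_unit_real dual sep]; blast)+
  show ?thesis
  proof (rule that)
    show "finite (hermitian_unit ` ?P)" using fin by (rule finite_imageI)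
    show "card (hermitian_unit ` ?P) = d\<^sup>2" using b(1) by (simp add: power2_eq_square)
  qed (fact b(2), fact b(3))
qed

end

section \<open>Simultaneous diagonalization of Hermitian forms\<close>

locale complex_endomorphism = vector_space scale
  for scale :: "complex \<Rightarrow> 'v::ab_group_add \<Rightarrow> 'v" +
  fixes T :: "'v \<Rightarrow> 'v"
  assumes T_add: "T (x + y) = T x + T y" and T_scale: "T (scale c x) = scale c (T x)"
begin

text \<open>
  The value of \<open>p(T)\<close> at \<open>x\<close>, by Horner's rule.
\<close>

definition poly_apply :: "complex poly \<Rightarrow> 'v \<Rightarrow> 'v" where
  "poly_apply p x = fold_coeffs (\<lambda>a y. scale a x + T y) p 0"

lemma T_zero: "T 0 = 0"
  using T_scale[of 0 0] by simp

lemma poly_apply_0: "poly_apply 0 x = 0"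
  by (simp add: poly_apply_def)

lemma poly_apply_pCons: "poly_apply (pCons a p) x = scale a x + T (poly_apply p x)"
  by (cases "p = 0 \<and> a = 0") (auto simp: poly_apply_def T_zero)

lemma poly_apply_add: "poly_apply (p + q) x = poly_apply p x + poly_apply q x"
  by (induction p q rule: poly_induct2)
     (simp_all add: poly_apply_0 poly_apply_pCons T_add scale_left_distrib)

lemma poly_apply_smult: "poly_apply (smult c p) x = scale c (poly_apply p x)"
  by (induction p) (simp_all add: poly_apply_0 poly_apply_pCons T_scale scale_right_distrib)

lemma poly_apply_sum: "poly_apply (\<Sum>i\<in>A. p i) x = (\<Sum>i\<in>A. poly_apply (p i) x)"
  by (induction A rule: infinite_finite_induct) (simp_all add: poly_apply_0 poly_apply_add)

lemma poly_apply_monom: "poly_apply (monom c n) x = scale c ((T ^^ n) x)"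
  by (induction n) (simp_all add: monom_0 monom_Suc poly_apply_0 poly_apply_pCons T_zero T_scale)

lemma poly_apply_linear_mult:
  "poly_apply ([:- \<mu>, 1:] * q) x = T (poly_apply q x) - scale \<mu> (poly_apply q x)"
proof -
  have "[:- \<mu>, 1:] * q = smult (- \<mu>) q + pCons 0 q" by simp
  then show ?thesis by (simp only: poly_apply_add poly_apply_smult poly_apply_pCons) simp
qed

lemma poly_apply_subspace:
  assumes "subspace U" "\<And>x. x \<in> U \<Longrightarrow> T x \<in> U" "x \<in> U"
  shows "poly_apply p x \<in> U"
  by (induction p)
     (auto simp: poly_apply_0 poly_apply_pCons intro!: assms subspace_0 subspace_add subspace_scale)

text \<open>
  The vectors \<open>x, T x, T\<^sup>2 x, \<dots>\<close> are linearly dependent, whether or not they are distinct.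
\<close>

lemma annihilating_polynomial:
  assumes B: "finite B" "span B = UNIV"
  shows "\<exists>p. p \<noteq> 0 \<and> poly_apply p x = 0"
proof (cases "inj_on (\<lambda>i. (T ^^ i) x) {..card B}")
  case True
  let ?S = "(\<lambda>i. (T ^^ i) x) ` {..card B}"
  have "card ?S = Suc (card B)" using card_image[OF True] by simp
  then have "dependent ?S" using independent_span_bound[OF B(1), of ?S] B(2) by auto
  then obtain u k where u: "k \<le> card B" "u ((T ^^ k) x) \<noteq> 0" "(\<Sum>v\<in>?S. scale (u v) v) = 0"
    by (auto simp: dependent_finite)
  define p where "p = (\<Sum>i\<le>card B. monom (u ((T ^^ i) x)) i)"
  have "poly_apply p x = (\<Sum>i\<le>card B. scale (u ((T ^^ i) x)) ((T ^^ i) x))"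
    by (simp add: p_def poly_apply_sum poly_apply_monom)
  also have "\<dots> = 0" using u(3) by (simp add: sum.reindex[OF True])
  finally have "poly_apply p x = 0" .
  moreover have "coeff p k \<noteq> 0" using u by (simp add: p_def coeff_sum)
  ultimately show ?thesis by (intro exI[of _ p]) auto
next
  case False
  then obtain i j where ij: "i \<noteq> j" "(T ^^ i) x = (T ^^ j) x" by (auto simp: inj_on_def)
  have "poly_apply (monom 1 i + monom (-1) j) x = 0"
    using ij by (simp add: poly_apply_add poly_apply_monom)
  moreover have "coeff (monom 1 i + monom (-1) j :: complex poly) i \<noteq> 0" using ij by simp
  ultimately show ?thesis by (metis coeff_0)
qed

text \<open>
  Take \<open>p \<noteq> 0\<close> of least degree with \<open>p(T) x = 0\<close> and split off a root, \<open>p = (X - \<mu>) q\<close>. Then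
  \<open>q(T) x\<close> is nonzero and an eigenvector.
\<close>

lemma eigenvector_in_invariant_subspace:
  assumes B: "finite B" "span B = UNIV" and U: "subspace U" "\<And>x. x \<in> U \<Longrightarrow> T x \<in> U"
    and x: "x \<in> U" "x \<noteq> 0"
  obtains y \<mu> where "y \<in> U" "y \<noteq> 0" "T y = scale \<mu> y"
proof -
  define p where "p = arg_min degree (\<lambda>p. p \<noteq> 0 \<and> poly_apply p x = 0)"
  have p: "p \<noteq> 0" "poly_apply p x = 0"
    and least: "\<And>q. q \<noteq> 0 \<Longrightarrow> poly_apply q x = 0 \<Longrightarrow> degree p \<le> degree q"
    using annihilating_polynomial[OF B, of x]
      arg_min_nat_lemma[of "\<lambda>p. p \<noteq> 0 \<and> poly_apply p x = 0" _ degree]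
    unfolding p_def by blast+
  have "degree p \<noteq> 0"
  proof
    assume "degree p = 0"
    then obtain a where "p = [:a:]" by (rule degree_eq_zeroE)
    then show False using p x by (simp add: poly_apply_pCons poly_apply_0 T_zero)
  qed
  then obtain \<mu> where "poly p \<mu> = 0"
    using fundamental_theorem_of_algebra[of p] constant_degree[of p] by auto
  then obtain q where q: "p = [:- \<mu>, 1:] * q" unfolding poly_eq_0_iff_dvd by (rule dvdE)
  have "q \<noteq> 0" using q p by auto
  then have "degree q < degree p" unfolding q using degree_mult_eq[of "[:- \<mu>, 1:]" q] by simp
  then have nz: "poly_apply q x \<noteq> 0" using least[OF \<open>q \<noteq> 0\<close>] by auto
  have "T (poly_apply q x) = scale \<mu> (poly_apply q x)"
    using p(2) poly_apply_linear_mult[of \<mu> q x] q by simp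
  with nz that show ?thesis using poly_apply_subspace[OF U x(1)] by blast
qed

text \<open>
  Take an orthonormal set of eigenvectors with as many elements as possible. Its orthogonal complement is invariant
  because \<open>T\<close> is self-adjoint; were it nonzero, it would contain a further eigenvector.
\<close>

lemma orthonormal_eigenbasis:
  fixes h :: "'v \<Rightarrow> 'v \<Rightarrow> complex"
  assumes B: "finite B" "span B = UNIV"
    and lin: "\<And>y. complex_linear scale (\<lambda>x. h x y)" and herm: "\<And>x y. h y x = cnj (h x y)"
    and pos: "\<And>x. x \<noteq> 0 \<Longrightarrow> Re (h x x) > 0"
    and self_adjoint: "\<And>x y. h (T x) y = h x (T y)"
  obtains E where "finite E" "\<not> dependent E" "span E = UNIV"
    "\<And>e e'. e \<in> E \<Longrightarrow> e' \<in> E \<Longrightarrow> h e e' = (if e = e' then 1 else 0)"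
    "\<And>e. e \<in> E \<Longrightarrow> \<exists>\<mu>. T e = scale \<mu> e"
proof -
  have hadd: "h (x + y) z = h x z + h y z" and hsc: "h (scale c x) z = c * h x z" for x y z c
    using lin[of z] by (auto simp: complex_linear_def)
  have hsc': "h z (scale c x) = cnj c * h z x" for x z c
    unfolding herm[of z "scale c x"] herm[of z x] hsc by simp
  have h0: "h 0 z = 0" for z using hsc[of 0 0 z] by simp
  have real: "h x x = complex_of_real (Re (h x x))" for x
    using herm[of x x] by (simp add: complex_eq_iff)
  define good where "good E \<longleftrightarrow> finite E \<and>
      (\<forall>e\<in>E. \<forall>e'\<in>E. h e e' = (if e = e' then 1 else 0)) \<and> (\<forall>e\<in>E. \<exists>\<mu>. T e = scale \<mu> e)" for E
  have indep: "\<not> dependent E" if E: "good E" for E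
  proof
    assume "dependent E"
    then obtain u e where u: "e \<in> E" "u e \<noteq> 0" "(\<Sum>v\<in>E. scale (u v) v) = 0"
      using E unfolding good_def by (auto simp: dependent_finite)
    have "h (\<Sum>v\<in>E. scale (u v) v) e = (\<Sum>v\<in>E. u v * h v e)"
      by (rule complex_linear_apply_sum[OF lin])
    also have "\<dots> = (\<Sum>v\<in>E. if v = e then u v else 0)"
      using E u unfolding good_def by (intro sum.cong refl) auto
    also have "\<dots> = u e" using u E unfolding good_def by simp
    finally show False using u h0 by simp
  qed
  have bound: "card E < Suc (card B)" if "good E" for E
    using independent_span_bound[OF B(1) indep[OF that]] B(2) by auto
  have "good {}" by (simp add: good_def)
  from ex_has_greatest_nat[of good, OF this, of card "Suc (card B)"] bound
  obtain E where E: "good E" and greatest: "\<And>F. good F \<Longrightarrow> card F \<le> card E" by blast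
  have fin: "finite E" and on: "h e e' = (if e = e' then 1 else 0)" if "e \<in> E" "e' \<in> E" for e e'
    using E that unfolding good_def by auto
  define U where "U = {x. \<forall>e\<in>E. h x e = 0}"
  have U: "subspace U" by (auto simp: U_def subspace_def hadd hsc h0)
  have TU: "T x \<in> U" if "x \<in> U" for x
    unfolding U_def
  proof (intro CollectI ballI)
    fix e assume e: "e \<in> E"
    then obtain \<mu> where "T e = scale \<mu> e" using E unfolding good_def by blast
    then show "h (T x) e = 0" using that e by (simp add: self_adjoint hsc' U_def)
  qed
  have U0: "x = 0" if "x \<in> U" for x
  proof (rule ccontr)
    assume "x \<noteq> 0"
    from eigenvector_in_invariant_subspace[OF B U TU that this]
    obtain y \<mu> where y: "y \<in> U" "y \<noteq> 0" "T y = scale \<mu> y" by blast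
    define r where "r = sqrt (Re (h y y))"
    have r: "r > 0" "h y y = complex_of_real (r * r)" using pos[OF y(2)] real[of y] by (auto simp: r_def)
    define z where "z = scale (complex_of_real (1 / r)) y"
    have zz: "h z z = 1" using r by (simp add: z_def hsc hsc' field_simps)
    have ze: "h z e = 0" if "e \<in> E" for e using y that by (simp add: z_def hsc U_def)
    have ez: "h e z = 0" if "e \<in> E" for e using ze[OF that] herm[of z e] by simp
    have "z \<notin> E" using ze zz by auto
    have "T z = scale \<mu> z" using y by (simp add: z_def T_scale mult.commute)
    then have "good (insert z E)"
      using E zz ze ez \<open>z \<notin> E\<close> unfolding good_def by auto
    then have "card (insert z E) \<le> card E" by (rule greatest)
    then show False using \<open>z \<notin> E\<close> E by (simp add: good_def)
  qed
  have "span E = UNIV"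
  proof -
    have "x \<in> span E" for x
    proof -
      define y where "y = (\<Sum>e\<in>E. scale (- h x e) e)"
      have "x + y \<in> U"
        unfolding U_def
      proof (intro CollectI ballI)
        fix e assume e: "e \<in> E"
        have "h y e = (\<Sum>e'\<in>E. - h x e' * h e' e)"
          unfolding y_def by (rule complex_linear_apply_sum[OF lin])
        also have "\<dots> = (\<Sum>e'\<in>E. if e' = e then - h x e' else 0)"
          using e by (intro sum.cong refl) (auto simp: on)
        also have "\<dots> = - h x e" using e fin by simp
        finally show "h (x + y) e = 0" by (simp add: hadd)
      qed
      then have "x = - y" using U0 by (simp add: eq_neg_iff_add_eq_0)
      moreover have "y \<in> span E" unfolding y_def by (intro span_sum span_scale span_base)
      ultimately show ?thesis by (simp add: span_neg)
    qed
    then show ?thesis by auto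
  qed
  with E indep[OF E] show ?thesis unfolding good_def by (intro that[of E]) auto
qed

end

text \<open>
  In the basis \<open>B\<close>, which is orthonormal for \<open>h1\<close>, the form \<open>h2\<close> is represented as \<open>h2 x y = h1 (T x) y\<close>
  with \<open>T\<close> self-adjoint; an orthonormal eigenbasis of \<open>T\<close> diagonalizes both forms.
\<close>

lemma simultaneous_diagonalization:
  fixes h1 h2 :: "'v::ab_group_add \<Rightarrow> 'v \<Rightarrow> complex"
  assumes vs: "vector_space sc" and B: "finite B" "\<not> module.dependent sc B" "module.span sc B = UNIV"
    and lin: "\<And>y. complex_linear sc (\<lambda>x. h1 x y)" "\<And>y. complex_linear sc (\<lambda>x. h2 x y)"
    and herm: "\<And>x y. h1 y x = cnj (h1 x y)" "\<And>x y. h2 y x = cnj (h2 x y)"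
    and pos: "\<And>x. x \<noteq> 0 \<Longrightarrow> Re (h1 x x) > 0"
    and on: "\<And>x y. h1 x y = (\<Sum>b\<in>B. module.representation sc B x b * cnj (module.representation sc B y b))"
  obtains E where "finite E" "\<not> module.dependent sc E" "module.span sc E = UNIV"
    "\<And>e e'. e \<in> E \<Longrightarrow> e' \<in> E \<Longrightarrow> h1 e e' = (if e = e' then 1 else 0)"
    "\<And>e e'. e \<in> E \<Longrightarrow> e' \<in> E \<Longrightarrow> e \<noteq> e' \<Longrightarrow> h2 e e' = 0"
proof -
  interpret vector_space sc by fact
  define T where "T x = (\<Sum>b\<in>B. sc (h2 x b) b)" for x
  have l2: "h2 (x + y) z = h2 x z + h2 y z" "h2 (sc c x) z = c * h2 x z" for x y z c
    using lin(2)[of z] by (auto simp: complex_linear_def)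
  interpret T: complex_endomorphism sc T
    by unfold_locales (simp_all add: T_def l2 scale_left_distrib sum.distrib scale_sum_right)
  have repr: "(\<Sum>b\<in>B. sc (representation B y b) b) = y" for y
    using sum_representation_eq[OF B(2), of y B] B by simp
  have h1b: "h1 b y = cnj (representation B y b)" if "b \<in> B" for b y
  proof -
    have "h1 b y = (\<Sum>b'\<in>B. if b' = b then cnj (representation B y b) else 0)"
      unfolding on using that by (intro sum.cong refl) (auto simp: representation_basis[OF B(2) that])
    then show ?thesis using that B by simp
  qed
  have adj: "h1 (T x) y = h2 x y" for x y
  proof -
    have "h1 (T x) y = (\<Sum>b\<in>B. h2 x b * h1 b y)"
      unfolding T_def by (rule complex_linear_apply_sum[OF lin(1)])
    also have "\<dots> = cnj (\<Sum>b\<in>B. representation B y b * h2 b x)"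
      unfolding cnj_sum by (intro sum.cong refl) (metis complex_cnj_mult h1b herm(2) mult.commute)
    also have "(\<Sum>b\<in>B. representation B y b * h2 b x) = h2 (\<Sum>b\<in>B. sc (representation B y b) b) x"
      by (rule complex_linear_apply_sum[OF lin(2), symmetric])
    also have "cnj \<dots> = h2 x y" unfolding repr by (rule herm(2)[symmetric])
    finally show ?thesis .
  qed
  have sa: "h1 (T x) y = h1 x (T y)" for x y
    using adj[of x y] adj[of y x] herm(1)[of "T y" x] herm(2)[of y x] by simp
  from T.orthonormal_eigenbasis[OF B(1,3) lin(1) herm(1) pos sa]
  obtain E where E: "finite E" "\<not> dependent E" "span E = UNIV"
    "\<And>e e'. e \<in> E \<Longrightarrow> e' \<in> E \<Longrightarrow> h1 e e' = (if e = e' then 1 else 0)"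
    "\<And>e. e \<in> E \<Longrightarrow> \<exists>\<mu>. T e = sc \<mu> e" by blast
  have "h2 e e' = 0" if e: "e \<in> E" "e' \<in> E" "e \<noteq> e'" for e e'
  proof -
    obtain \<mu> where "T e = sc \<mu> e" using E(5) e by blast
    then have "h2 e e' = h1 (sc \<mu> e) e'" using adj by metis
    also have "\<dots> = \<mu> * h1 e e'" using lin(1)[of e'] by (simp add: complex_linear_def)
    finally show ?thesis using E(4) e by simp
  qed
  with E show ?thesis by (intro that[of E]) auto
qed

section \<open>The Hodge-Riemann property\<close>

lemma sesq_form10_wedge_form01: "sesq 1 (cscale \<i> (form10 f \<and>\<and> form01 g)) [v] [w] = f v * g w"
proof -
  have "Pow {..<Suc 0} = {{}, {0}}" "inversions {} = 0" by (auto simp: inversions_def)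
  then show ?thesis
    by (simp add: sesq_def cscale_def wedge_def form10_def form01_def inversions_single)
qed

lemma kaehler_form_sesq:
  assumes "vector_space sc" "kaehler_form sc \<omega>"
  obtains B where "finite B" "\<not> module.dependent sc B" "module.span sc B = UNIV"
    "\<And>v w. sesq 1 \<omega> [v] [w] = (\<Sum>b\<in>B. module.representation sc B v b * cnj (module.representation sc B w b))"
proof -
  from assms(2) obtain B where B: "finite B" "\<not> module.dependent sc B" "module.span sc B = UNIV"
    and \<omega>: "\<omega> = cscale \<i> (\<Sum>b\<in>B. form10 (\<lambda>v. module.representation sc B v b) \<and>\<and>
                            form01 (\<lambda>v. cnj (module.representation sc B v b)))"
    unfolding kaehler_form_def by blast
  have "\<omega> = (\<Sum>b\<in>B. cscale \<i> (form10 (\<lambda>v. module.representation sc B v b) \<and>\<and>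
                            form01 (\<lambda>v. cnj (module.representation sc B v b))))"
    unfolding \<omega> by (intro ext) (simp add: cscale_def sum_form_apply sum_distrib_left)
  then have "sesq 1 \<omega> [v] [w] = (\<Sum>b\<in>B. module.representation sc B v b * cnj (module.representation sc B w b))" for v w
    by (simp only: sesq_sum sesq_form10_wedge_form01)
  with B that show ?thesis by blast
qed

lemma kaehler_form_real: "kaehler_form sc \<omega> \<Longrightarrow> \<omega> \<in> real_forms sc 1"
  by (simp add: kaehler_form_def)

lemma kaehler_form_pos:
  assumes "vector_space sc" "kaehler_form sc \<omega>" "v \<noteq> 0"
  shows "Re (sesq 1 \<omega> [v] [v]) > 0"
proof -
  interpret vector_space sc by fact
  obtain B where B: "finite B" "\<not> dependent B" "span B = UNIV"
    and h: "\<And>v w. sesq 1 \<omega> [v] [w] = (\<Sum>b\<in>B. representation B v b * cnj (representation B w b))"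
    using kaehler_form_sesq[OF assms(1,2)] by blast
  have "\<exists>b\<in>B. representation B v b \<noteq> 0"
  proof (rule ccontr)
    assume "\<not> (\<exists>b\<in>B. representation B v b \<noteq> 0)"
    then have "(\<Sum>b\<in>B. sc (representation B v b) b) = 0" by (intro sum.neutral) auto
    then show False using sum_representation_eq[OF B(2), of v B] B assms(3) by simp
  qed
  then obtain b where b: "b \<in> B" "representation B v b \<noteq> 0" by blast
  have "Re (sesq 1 \<omega> [v] [v]) = (\<Sum>b\<in>B. (cmod (representation B v b))\<^sup>2)"
    unfolding h by (simp add: complex_mult_cnj cmod_power2)
  also have "\<dots> > 0" using B b by (intro sum_pos2[of B b]) auto
  finally show ?thesis .
qed

text \<open>
  Evaluate \<open>h\<close> at \<open>x = h v v * u - h u v * v\<close>, the component of \<open>u\<close> orthogonal to \<open>v\<close> up to a factor: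
  \<open>h x x\<close> is \<open>h v v\<close> times the minor.
\<close>

lemma positive_definite_minor:
  assumes vs: "vector_space sc" and lin: "\<And>y. complex_linear sc (\<lambda>x. h x y)" and herm: "\<And>x y. h y x = cnj (h x y)"
    and pos: "\<And>x. x \<noteq> 0 \<Longrightarrow> Re (h x x) > 0"
    and indep: "\<not> module.dependent sc S" "u \<in> S" "v \<in> S" "u \<noteq> v"
  shows "Re (h u u * h v v - h u v * h v u) > 0"
proof -
  interpret vector_space sc by fact
  have hadd: "h (x + y) z = h x z + h y z" and hsc: "h (sc c x) z = c * h x z" for x y z c
    using lin[of z] by (auto simp: complex_linear_def)
  have hadd': "h z (x + y) = h z x + h z y" for x y z
    unfolding herm[of z "x + y"] herm[of z x] herm[of z y] hadd by simp
  have hsc': "h z (sc c x) = cnj c * h z x" for x z c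
    unfolding herm[of z "sc c x"] herm[of z x] hsc by simp
  have "v \<noteq> 0" using indep dependent_zero by blast
  then have p: "Re (h v v) > 0" by (rule pos)
  have real: "h v v = complex_of_real (Re (h v v))"
    using herm[of v v] by (simp add: complex_eq_iff)
  define a where "a = Re (h v v)"
  have hv: "h v v = complex_of_real a" unfolding a_def by (rule real)
  define x where "x = sc (h v v) u + sc (- h u v) v"
  have "x \<noteq> 0"
  proof
    assume "x = 0"
    then have eq: "sc (h v v) u = sc (h u v) v" by (simp add: x_def)
    have "h v v \<noteq> 0" using p by auto
    then have "u = sc (1 / h v v) (sc (h v v) u)" by simp
    then have "u = sc (1 / h v v) (sc (h u v) v)" unfolding eq .
    moreover have "sc (1 / h v v) (sc (h u v) v) \<in> span {v}" by (intro span_scale span_base insertI1)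
    ultimately have "u \<in> span {v}" by metis
    moreover have "{v} \<subseteq> S - {u}" using indep by auto
    ultimately have "u \<in> span (S - {u})" using span_mono by blast
    then show False using indep unfolding dependent_def by blast
  qed
  then have "Re (h x x) > 0" by (rule pos)
  moreover have "h x x = complex_of_real a * (h u u * h v v - h u v * h v u)"
    unfolding x_def hadd hadd' hsc hsc'
    by (simp add: herm[of u v] hv algebra_simps)
  ultimately show ?thesis using p by (simp add: a_def zero_less_mult_iff)
qed

lemma sum_offdiag_swap:
  assumes "finite S"
  shows "(\<Sum>x\<in>S. \<Sum>z\<in>S - {x}. f x z) = (\<Sum>x\<in>S. \<Sum>z\<in>S - {x}. f z x)"
proof -
  have *: "(\<Sum>x\<in>S. \<Sum>z\<in>S - {x}. g x z) = (\<Sum>x\<in>S. \<Sum>z\<in>S. if x = z then 0 else g x z)" for g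
    using assms by (intro sum.cong refl sum.mono_neutral_cong_left) auto
  show ?thesis unfolding *
    by (subst sum.swap) (intro sum.cong refl, auto)
qed

lemma integral_prod_pencil_pos:
  assumes "finite S" "\<And>i. i \<in> S \<Longrightarrow> lam i > 0"
  shows "integral {0..1} (\<lambda>t. \<Prod>i\<in>S. pencil (lam i) t) > 0"
proof -
  have "0 < (\<Sum>A\<in>Pow S. fact (card A) * fact (card (S - A)) * (\<Prod>i\<in>S - A. lam i))"
    using assms by (intro sum_pos) (auto intro!: mult_pos_pos prod_pos)
  then have "0 < fact (card S + 1) * integral {0..1} (\<lambda>t. \<Prod>i\<in>S. pencil (lam i) t)"
    unfolding integral_prod_pencil[OF assms(1)] .
  then show ?thesis by (simp only: zero_less_mult_iff) (use fact_gt_zero[of "card S + 1", where ?'a = real] in linarith)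
qed

context complex_basis begin

lemma real_form11_diag_real:
  "\<alpha> \<in> real_forms scale 1 \<Longrightarrow> sesq 1 \<alpha> [x] [x] = complex_of_real (Re (sesq 1 \<alpha> [x] [x]))"
  using real_forms_hermitian[of \<alpha> scale 1 "[x]" "[x]"] by (simp add: complex_eq_iff)

text \<open>
  The bilinear form is positive at \<open>\<omega>1\<close>, whose matrix is the identity. On the hyperplane \<open>\<phi> = 0\<close> it is
  negative: if the diagonal of \<open>\<alpha>\<close> is not zero, by \<open>hessian_negative_on_hyperplane\<close>, and otherwise
  because \<open>\<alpha>\<close> has a nonzero entry off the diagonal.
\<close>

lemma hodge_riemann_complete_homogeneous:
  assumes d2: "d \<ge> 2" and L: "positive_integral scale d L"
    and \<omega>: "kaehler_form scale \<omega>"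
    and \<omega>1: "\<omega>1 \<in> real_forms scale 1" "diagonal_on (set bs) 1 \<omega>1 (\<lambda>S. 1)"
    and \<omega>2: "\<omega>2 \<in> real_forms scale 1" "diagonal_on (set bs) 1 \<omega>2 (\<lambda>S. \<Prod>x\<in>S. lam x)"
    and lam: "\<And>x. x \<in> set bs \<Longrightarrow> lam x > 0"
  shows "hodge_riemann scale d L \<omega> (\<Sum>j\<le>d - 2. wpow \<omega>1 (d - 2 - j) \<and>\<and> wpow \<omega>2 j)"
proof -
  note vs = vector_space_axioms
  define m where "m = d - 2"
  have dm: "d = m + 2" using d2 by (simp add: m_def)
  define \<Omega> where "\<Omega> = (\<Sum>j\<le>m. wpow \<omega>1 (m - j) \<and>\<and> wpow \<omega>2 j)"
  define I where "I S = integral {0..1} (\<lambda>t. \<Prod>i\<in>S. pencil (lam i) t)" for S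
  define c where "c S = fact (m + 1) * I S" for S
  have \<Omega>_diag: "diagonal_on (set bs) m \<Omega> c"
    unfolding \<Omega>_def c_def I_def by (rule diagonal_complete_homogeneous[OF \<omega>1(2) \<omega>2(2)])
  have Ipos: "I S > 0" if "S \<subseteq> set bs" for S
    unfolding I_def using that lam finite_subset by (intro integral_prod_pencil_pos) auto
  have cpos: "c S > 0" if "S \<subseteq> set bs" for S
    unfolding c_def using Ipos[OF that] by (intro mult_pos_pos) auto
  have \<Omega>_real: "\<Omega> \<in> real_forms scale m"
    unfolding \<Omega>_def
  proof (rule real_forms_sum[OF vs])
    fix j assume "j \<in> {..m}"
    then show "wpow \<omega>1 (m - j) \<and>\<and> wpow \<omega>2 j \<in> real_forms scale m"
      using wedge_real_forms[OF vs wpow_real[OF vs \<omega>1(1), of "m - j"] wpow_real[OF vs \<omega>2(1), of j]] by simp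
  qed
  obtain \<kappa> where \<kappa>: "\<kappa> > 0" "\<And>\<beta>. \<beta> \<in> real_forms scale d \<Longrightarrow> L \<beta> = \<kappa> * Re (sesq d \<beta> bs bs)"
    using integral_eq_value_on_basis[OF L] by blast
  note \<omega>_real = kaehler_form_real[OF \<omega>]
  have minor: "Re (sesq 1 \<omega> [u] [u] * sesq 1 \<omega> [v] [v] - sesq 1 \<omega> [u] [v] * sesq 1 \<omega> [v] [u]) > 0"
    if "u \<in> set bs" "v \<in> set bs" "u \<noteq> v" for u v
    by (rule positive_definite_minor[OF vs real_form11_complex_linear[OF vs \<omega>_real] real_forms_hermitian[OF \<omega>_real]
          kaehler_form_pos[OF vs \<omega>] indep_bs that])
  have pos: "L (\<Omega> \<and>\<and> wpow \<omega> 2) > 0"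
  proof -
    have w2: "wpow \<omega> 2 \<in> real_forms scale 2" by (rule wpow_real[OF vs \<omega>_real])
    let ?t = "\<lambda>K. Re (sesq m \<Omega> (nths bs K) (nths bs K) * sesq 2 (wpow \<omega> 2) (nths bs (- K)) (nths bs (- K)))"
    have t_pos: "?t K > 0" if K: "K \<subseteq> {..<d}" "card K = m" for K
    proof -
      have l1: "length (nths bs K) = m" using length_nths_lessThan[OF K(1)] K(2) by simp
      have "length (nths bs (- K)) = 2" using length_nths_split[of bs K] l1 dm by simp
      then obtain u v where uv: "nths bs (- K) = [u, v]" by (auto simp: numeral_2_eq_2 length_Suc_conv)
      then have uv': "u \<noteq> v" "u \<in> set bs" "v \<in> set bs"
        using distinct_nthsI[OF distinct_bs, of "- K"] set_nths_subset[of bs "- K"] by auto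
      have "sesq m \<Omega> (nths bs K) (nths bs K) = complex_of_real (c (set (nths bs K)))"
        by (rule diagonal_on_diag[OF \<Omega>_diag distinct_nthsI[OF distinct_bs] set_nths_subset l1])
      moreover have "sesq 2 (wpow \<omega> 2) [u, v] [u, v] =
          2 * (sesq 1 \<omega> [u] [u] * sesq 1 \<omega> [v] [v] - sesq 1 \<omega> [u] [v] * sesq 1 \<omega> [v] [u])"
        by (rule sesq_square_pair[OF real_forms_supported[OF \<omega>_real] uv'(1)])
      ultimately have "?t K = c (set (nths bs K)) * (2 *
          Re (sesq 1 \<omega> [u] [u] * sesq 1 \<omega> [v] [v] - sesq 1 \<omega> [u] [v] * sesq 1 \<omega> [v] [u]))"
        by (simp add: uv)
      also have "\<dots> > 0" using cpos[OF set_nths_subset] minor[OF uv'(2,3,1)] by simp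
      finally show ?thesis .
    qed
    have t_nonneg: "?t K \<ge> 0" if K: "K \<in> Pow {..<d}" for K
    proof (cases "card K = m")
      case False
      then have "length (nths bs K) \<noteq> m" using length_nths_lessThan[of K bs] K by simp
      then have "\<Omega> (nths bs K) (nths bs K) = 0"
        using diagonal_on_supported[OF \<Omega>_diag] unfolding supported_def by blast
      then have z: "sesq m \<Omega> (nths bs K) (nths bs K) = 0" by simp
      show ?thesis unfolding z by simp
    qed (use t_pos[of K] K in auto)
    have "Re (sesq d (\<Omega> \<and>\<and> wpow \<omega> 2) bs bs) = (\<Sum>K\<in>Pow {..<d}. ?t K)"
      unfolding Re_sum[symmetric]
      using sesq_wedge_diagonal[OF \<Omega>_diag real_forms_supported[OF w2] distinct_bs order_refl]
      by (simp only: dm[symmetric])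
    also have "\<dots> > 0"
      using t_pos[of "{..<m}"] dm by (intro sum_pos2[of _ "{..<m}"] t_nonneg) auto
    finally show ?thesis
      using \<kappa>(1) \<kappa>(2)[of "\<Omega> \<and>\<and> wpow \<omega> 2"] wedge_real_forms[OF vs \<Omega>_real w2] dm by simp
  qed
  define a where "a \<alpha> x z = sesq 1 \<alpha> [x] [z]" for \<alpha> :: "'v form" and x z
  define b where "b \<alpha> \<beta> = L (\<alpha> \<and>\<and> \<Omega> \<and>\<and> \<beta>)" for \<alpha> \<beta>
  let ?W = "real_forms scale 1"
  have b_eq: "b \<alpha> \<beta> = \<kappa> * (\<Sum>x\<in>set bs. \<Sum>z\<in>set bs - {x}. c (set bs - {x, z}) *
      Re (a \<alpha> x x * a \<beta> z z - a \<alpha> x z * a \<beta> z x))" if "\<alpha> \<in> ?W" "\<beta> \<in> ?W" for \<alpha> \<beta>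
  proof -
    have "\<alpha> \<and>\<and> \<Omega> \<and>\<and> \<beta> \<in> real_forms scale d"
      using wedge_real_forms[OF vs that(1) wedge_real_forms[OF vs \<Omega>_real that(2)]] dm by simp
    from \<kappa>(2)[OF this] show ?thesis
      unfolding b_def a_def
      using sesq_sandwich_diagonal[OF real_forms_supported[OF that(1)] real_forms_supported[OF that(2)]
          \<Omega>_diag distinct_bs dm] dm
      by simp
  qed
  have a_add: "a (\<alpha> + \<beta>) x z = a \<alpha> x z + a \<beta> x z" for \<alpha> \<beta> x z by (simp add: a_def sesq_add)
  have a_sc: "a (rscale r \<alpha>) x z = r * a \<alpha> x z" for r \<alpha> x z by (simp add: a_def sesq_rscale)
  have a_herm: "a \<alpha> z x = cnj (a \<alpha> x z)" if "\<alpha> \<in> ?W" for \<alpha> x z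
    unfolding a_def by (rule real_forms_hermitian[OF that])
  have sym: "b \<alpha> \<beta> = b \<beta> \<alpha>" if "\<alpha> \<in> ?W" "\<beta> \<in> ?W" for \<alpha> \<beta>
    unfolding b_eq[OF that] b_eq[OF that(2,1)]
    by (subst sum_offdiag_swap) (simp_all add: insert_commute mult.commute)
  have add: "b (\<alpha> + \<beta>) \<gamma> = b \<alpha> \<gamma> + b \<beta> \<gamma>" if "\<alpha> \<in> ?W" "\<beta> \<in> ?W" "\<gamma> \<in> ?W" for \<alpha> \<beta> \<gamma>
    unfolding b_eq[OF that(1,3)] b_eq[OF that(2,3)] b_eq[OF real_forms_add[OF vs that(1,2)] that(3)]
      distrib_left[symmetric] sum.distrib[symmetric] a_add
    by (intro arg_cong[of _ _ "(*) \<kappa>"] sum.cong refl) (simp add: algebra_simps)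
  have hom: "b (rscale r \<alpha>) \<gamma> = r * b \<alpha> \<gamma>" if "\<alpha> \<in> ?W" "\<gamma> \<in> ?W" for r \<alpha> \<gamma>
    unfolding b_eq[OF that] b_eq[OF real_forms_rscale[OF vs that(1)] that(2)]
      mult.left_commute[of r \<kappa>] sum_distrib_left[of r] a_sc
    by (intro arg_cong[of _ _ "(*) \<kappa>"] sum.cong refl) (simp add: algebra_simps)
  define D where "D \<alpha> x = Re (a \<alpha> x x)" for \<alpha> x
  \<comment> \<open>The gradient at \<open>0\<close> of \<open>u \<mapsto> \<integral> \<Prod>i. (l\<^sub>i + u\<^sub>i)\<close>, applied to the diagonal of the matrix of \<open>\<alpha>\<close>.\<close>
  define \<phi> where "\<phi> \<alpha> = (\<Sum>x\<in>set bs. D \<alpha> x * I (set bs - {x}))" for \<alpha>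
  have fadd: "\<phi> (\<alpha> + \<beta>) = \<phi> \<alpha> + \<phi> \<beta>" for \<alpha> \<beta>
    by (simp add: \<phi>_def D_def a_add distrib_right sum.distrib)
  have fhom: "\<phi> (rscale r \<alpha>) = r * \<phi> \<alpha>" for r \<alpha>
    by (simp add: \<phi>_def D_def a_sc sum_distrib_left mult.assoc)
  have b_square: "b \<alpha> \<alpha> = \<kappa> * (fact (m + 1) * (\<Sum>x\<in>set bs. \<Sum>z\<in>set bs - {x}. D \<alpha> x * D \<alpha> z * I (set bs - {x, z}))
      - (\<Sum>x\<in>set bs. \<Sum>z\<in>set bs - {x}. c (set bs - {x, z}) * (cmod (a \<alpha> x z))\<^sup>2))" if \<alpha>: "\<alpha> \<in> ?W" for \<alpha>
  proof -
    have re: "Re (a \<alpha> x x * a \<alpha> z z - a \<alpha> x z * a \<alpha> z x) = D \<alpha> x * D \<alpha> z - (cmod (a \<alpha> x z))\<^sup>2" for x z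
    proof -
      have "a \<alpha> y y = complex_of_real (D \<alpha> y)" for y
        unfolding a_def D_def by (rule real_form11_diag_real[OF \<alpha>])
      moreover have "a \<alpha> x z * a \<alpha> z x = complex_of_real ((cmod (a \<alpha> x z))\<^sup>2)"
        unfolding a_herm[OF \<alpha>, of z x] complex_norm_square ..
      ultimately show ?thesis by (simp del: of_real_power)
    qed
    show ?thesis
      unfolding b_eq[OF \<alpha> \<alpha>] re sum_distrib_left sum_subtractf[symmetric] c_def
      by (intro sum.cong refl) (simp add: algebra_simps)
  qed
  have off_nonneg: "(\<Sum>z\<in>set bs - {x}. c (set bs - {x, z}) * (cmod (a \<alpha> x z))\<^sup>2) \<ge> 0" for x \<alpha>
    using cpos by (intro sum_nonneg mult_nonneg_nonneg) (auto intro: less_imp_le)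
  have neg: "b \<alpha> \<alpha> < 0" if \<alpha>: "\<alpha> \<in> ?W" "\<alpha> \<noteq> 0" "\<phi> \<alpha> = 0" for \<alpha>
  proof (cases "\<exists>x\<in>set bs. D \<alpha> x \<noteq> 0")
    case True
    then obtain x where x: "x \<in> set bs" "D \<alpha> x \<noteq> 0" by blast
    have "(\<Sum>x\<in>set bs. \<Sum>z\<in>set bs - {x}. D \<alpha> x * D \<alpha> z * I (set bs - {x, z})) < 0"
      unfolding I_def
      by (rule hessian_negative_on_hyperplane[where I = "set bs" and lam = lam and a = "D \<alpha>", OF _ lam _ x]) (use \<alpha>(3) in \<open>simp_all add: \<phi>_def I_def\<close>)
    then have "fact (m + 1) * (\<Sum>x\<in>set bs. \<Sum>z\<in>set bs - {x}. D \<alpha> x * D \<alpha> z * I (set bs - {x, z})) < 0"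
      by (intro mult_pos_neg) auto
    moreover have "(\<Sum>x\<in>set bs. \<Sum>z\<in>set bs - {x}. c (set bs - {x, z}) * (cmod (a \<alpha> x z))\<^sup>2) \<ge> 0"
      by (intro sum_nonneg off_nonneg)
    ultimately show ?thesis unfolding b_square[OF \<alpha>(1)] using \<kappa>(1) by (intro mult_pos_neg) linarith+
  next
    case False
    then have D0: "D \<alpha> x = 0" if "x \<in> set bs" for x using that by blast
    obtain x z where xz: "x \<in> set bs" "z \<in> set bs" "a \<alpha> x z \<noteq> 0"
      using real_form11_eq_zero[OF \<alpha>(1)] \<alpha>(2) unfolding a_def by blast
    have "x \<noteq> z"
    proof
      assume "x = z"
      then show False using D0[OF xz(1)] xz(3) real_form11_diag_real[OF \<alpha>(1), of x] by (simp add: a_def D_def)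
    qed
    then have "(\<Sum>z\<in>set bs - {x}. c (set bs - {x, z}) * (cmod (a \<alpha> x z))\<^sup>2) > 0"
      using xz cpos by (intro sum_pos2[of _ z] mult_nonneg_nonneg) (auto intro: less_imp_le)
    then have "(\<Sum>x\<in>set bs. \<Sum>z\<in>set bs - {x}. c (set bs - {x, z}) * (cmod (a \<alpha> x z))\<^sup>2) > 0"
      using xz(1) off_nonneg by (intro sum_pos2[OF finite_set xz(1)])
    then show ?thesis unfolding b_square[OF \<alpha>(1)] using \<kappa>(1) D0 by (simp add: mult_pos_neg)
  qed
  have \<omega>1_pos: "b \<omega>1 \<omega>1 > 0"
  proof -
    have on: "a \<omega>1 x x = 1" if "x \<in> set bs" for x
      using diagonal_on_diag[OF \<omega>1(2), of "[x]"] that by (simp add: a_def)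
    have off: "a \<omega>1 x z = 0" if "x \<in> set bs" "z \<in> set bs" "x \<noteq> z" for x z
      using diagonal_on_off[OF \<omega>1(2), of "[x]" "[z]"] that by (simp add: a_def)
    have "b \<omega>1 \<omega>1 = \<kappa> * (\<Sum>x\<in>set bs. \<Sum>z\<in>set bs - {x}. c (set bs - {x, z}))"
      unfolding b_eq[OF \<omega>1(1) \<omega>1(1)]
      by (intro arg_cong[of _ _ "(*) \<kappa>"] sum.cong refl) (auto simp: on off)
    also have "\<dots> > 0"
    proof (intro mult_pos_pos \<kappa>(1) sum_pos)
      show "set bs \<noteq> {}" using dm by auto
      show "set bs - {x} \<noteq> {}" if "x \<in> set bs" for x
      proof
        assume "set bs - {x} = {}"
        then have "set bs = {x}" using that by auto
        then show False using distinct_card[OF distinct_bs] dm by simp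
      qed
    qed (auto intro!: cpos)
    finally show ?thesis .
  qed
  obtain T where T: "finite T" "\<not> module.dependent rscale T" "module.span rscale T = ?W" "card T = d\<^sup>2"
    using real_forms11_basis by blast
  obtain N where N: "finite N" "\<omega>1 \<notin> N" "card N = card T - 1" "\<not> module.dependent rscale (insert \<omega>1 N)"
    "module.span rscale (insert \<omega>1 N) = ?W"
    "\<And>x y. x \<in> insert \<omega>1 N \<Longrightarrow> y \<in> insert \<omega>1 N \<Longrightarrow> x \<noteq> y \<Longrightarrow> b x y = 0" "\<And>x. x \<in> N \<Longrightarrow> b x x < 0"
  proof (rule lorentzian_orthogonal_basis[where s = rscale and T = T and W = ?W and b = b and ?x0.0 = \<omega>1 and \<phi> = \<phi>])
    fix N assume "finite N" "\<omega>1 \<notin> N" "card N = card T - 1" "\<not> module.dependent rscale (insert \<omega>1 N)"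
      "module.span rscale (insert \<omega>1 N) = ?W"
      "\<And>x y. x \<in> insert \<omega>1 N \<Longrightarrow> y \<in> insert \<omega>1 N \<Longrightarrow> x \<noteq> y \<Longrightarrow> b x y = 0" "\<And>x. x \<in> N \<Longrightarrow> b x x < 0"
    then show thesis by (rule that)
  qed (rule vector_space_rscale T(1-3) \<omega>1(1) \<omega>1_pos fadd fhom | rule sym add hom neg; assumption)+
  have "has_signature ?W b 1 (d\<^sup>2 - 1)"
    unfolding has_signature_def
  proof (intro conjI)
    show "\<exists>P N. finite P \<and> finite N \<and> P \<inter> N = {} \<and> card P = 1 \<and> card N = d\<^sup>2 - 1 \<and>
        \<not> module.dependent rscale (P \<union> N) \<and> module.span rscale (P \<union> N) = ?W \<and>
        (\<forall>x\<in>P \<union> N. \<forall>y\<in>P \<union> N. x \<noteq> y \<longrightarrow> b x y = 0) \<and> (\<forall>x\<in>P. b x x > 0) \<and> (\<forall>x\<in>N. b x x < 0)"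
    proof (intro exI conjI)
      show "{\<omega>1} \<inter> N = {}" using N(2) by simp
      show "card N = d\<^sup>2 - 1" using N(3) T(4) by simp
      show "\<not> module.dependent rscale ({\<omega>1} \<union> N)" "module.span rscale ({\<omega>1} \<union> N) = ?W"
        using N(4,5) by simp_all
      show "\<forall>x\<in>{\<omega>1} \<union> N. \<forall>y\<in>{\<omega>1} \<union> N. x \<noteq> y \<longrightarrow> b x y = 0" using N(6) by simp
    qed (use N \<omega>1_pos in auto)
  qed (use sym add hom in blast)+
  then show ?thesis
    unfolding hodge_riemann_def m_def[symmetric] \<Omega>_def[symmetric]
    using \<Omega>_real pos by (simp add: b_def[abs_def])
qed

end

theorem proposition1p6:
  fixes scale :: "complex \<Rightarrow> 'v::ab_group_add \<Rightarrow> 'v"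
    and d :: nat
    and L :: "'v form \<Rightarrow> real"
    and \<omega> \<omega>1 \<omega>2 :: "'v form"
  assumes "vector_space scale"
    and "vector_space.dim scale (UNIV :: 'v set) = d"
    and "d \<ge> 2"
    and "positive_integral scale d L"
    and "kaehler_form scale \<omega>"
    and "kaehler_form scale \<omega>1"
    and "kaehler_form scale \<omega>2"
  shows "hodge_riemann scale d L \<omega> (\<Sum>j\<le>d - 2. wpow \<omega>1 (d - 2 - j) \<and>\<and> wpow \<omega>2 j)"
proof -
  note vs = assms(1) and r1 = kaehler_form_real[OF assms(6)] and r2 = kaehler_form_real[OF assms(7)]
  interpret vector_space scale by fact
  obtain B where B: "finite B" "\<not> dependent B" "span B = UNIV"
    "\<And>v w. sesq 1 \<omega>1 [v] [w] = (\<Sum>b\<in>B. representation B v b * cnj (representation B w b))"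
    using kaehler_form_sesq[OF vs assms(6)] by blast
  obtain E where E: "finite E" "\<not> dependent E" "span E = UNIV"
    "\<And>e e'. e \<in> E \<Longrightarrow> e' \<in> E \<Longrightarrow> sesq 1 \<omega>1 [e] [e'] = (if e = e' then 1 else 0)"
    "\<And>e e'. e \<in> E \<Longrightarrow> e' \<in> E \<Longrightarrow> e \<noteq> e' \<Longrightarrow> sesq 1 \<omega>2 [e] [e'] = 0"
    using simultaneous_diagonalization[OF vs B(1,2,3) real_form11_complex_linear[OF vs r1] real_form11_complex_linear[OF vs r2]
        real_forms_hermitian[OF r1] real_forms_hermitian[OF r2] kaehler_form_pos[OF vs assms(6)] B(4)]
    by blast
  obtain bs where bs: "distinct bs" "set bs = E" using finite_distinct_list[OF E(1)] by blast
  interpret b: complex_basis scale bs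
    by unfold_locales (use bs E in simp_all)
  have d: "d = length bs"
    using dim_eq_card[of E UNIV] E assms(2) distinct_card[OF bs(1)] bs(2) by simp
  define lam where "lam e = Re (sesq 1 \<omega>2 [e] [e])" for e
  have lam: "lam e > 0" if "e \<in> E" for e
    unfolding lam_def using that E(2) dependent_zero by (intro kaehler_form_pos[OF vs assms(7)]) blast
  have diag: "diagonal_on E 1 \<beta> (\<lambda>S. \<Prod>x\<in>S. l x)"
    if "\<beta> \<in> real_forms scale 1" "\<And>e. e \<in> E \<Longrightarrow> sesq 1 \<beta> [e] [e] = complex_of_real (l e)"
      "\<And>e e'. e \<in> E \<Longrightarrow> e' \<in> E \<Longrightarrow> e \<noteq> e' \<Longrightarrow> sesq 1 \<beta> [e] [e'] = 0" for \<beta> and l :: "'v \<Rightarrow> real"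
    unfolding diagonal_on_def
  proof (intro conjI allI impI)
    show s: "supported 1 \<beta>" by (rule real_forms_supported[OF that(1)])
    fix vs :: "'v list"
    show "sesq 1 \<beta> vs vs = (\<Prod>x\<in>set vs. l x)" if "set vs \<subseteq> E" "length vs = 1"
      using that \<open>\<And>e. e \<in> E \<Longrightarrow> sesq 1 \<beta> [e] [e] = complex_of_real (l e)\<close> by (auto simp: length_Suc_conv)
    fix ws :: "'v list"
    show "\<beta> vs ws = 0" if E: "set vs \<subseteq> E" "set ws \<subseteq> E" "set vs \<noteq> set ws"
    proof (cases "length vs = 1 \<and> length ws = 1")
      case True
      then obtain v w where "vs = [v]" "ws = [w]" by (auto simp: length_Suc_conv)
      then show ?thesis using that \<open>\<And>e e'. e \<in> E \<Longrightarrow> e' \<in> E \<Longrightarrow> e \<noteq> e' \<Longrightarrow> sesq 1 \<beta> [e] [e'] = 0\<close>[of v w] by simp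
    next
      case False
      then show ?thesis using s unfolding supported_def by blast
    qed
  qed
  have "diagonal_on E 1 \<omega>1 (\<lambda>S. \<Prod>x\<in>S. 1)"
  proof (rule diag[OF r1])
    show "sesq 1 \<omega>1 [e] [e] = complex_of_real 1" if "e \<in> E" for e using E(4)[OF that that] by simp
    show "sesq 1 \<omega>1 [e] [e'] = 0" if "e \<in> E" "e' \<in> E" "e \<noteq> e'" for e e'
      using E(4)[OF that(1,2)] that(3) by simp
  qed
  then have "diagonal_on (set bs) 1 \<omega>1 (\<lambda>S. 1)" using bs(2) by simp
  moreover have "diagonal_on (set bs) 1 \<omega>2 (\<lambda>S. \<Prod>x\<in>S. lam x)"
    unfolding bs(2) lam_def
    by (rule diag[OF r2 b.real_form11_diag_real[OF r2] E(5)])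
  ultimately show ?thesis
    using b.hodge_riemann_complete_homogeneous[of L \<omega> \<omega>1 \<omega>2 lam] assms(3-5) r1 r2 lam bs(2)
    unfolding d by blast
qed

end
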